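(* Let $X$ be a centered non-degenerate self-decomposable random vector in $\mathbb{R}^d$ ($d\ge1$) without Gaussian component, with law $\mu_X$ and Lévy measure $\nu$, such that $\mathbb{E}\|X\|^2<+\infty$, and such that the functions $k_x$ of the polar decomposition of $\nu$ (see context) satisfy $\sup_{x\in S^{d-1}}\sup_{r\in(a,b)}k_x(r)<+\infty$ for all $0<a<b<+\infty$. Let $Y$ be a centered non-degenerate random vector in $\mathbb{R}^d$ with law $\mu_Y$, with $\mathbb{E}\|Y\|^2<+\infty$, such that $\nu\ast\mu_Y\ll\mu_Y$ and such that $Y$ satisfies, with some $1\le U_Y<+\infty$, the Poincaré inequality $$\mathbb{E}\|f(Y)-\mathbb{E}f(Y)\|^2\le U_Y\,\mathbb{E}\int_{\mathbb{R}^d}\|f(Y+u)-f(Y)\|^2\nu(du)\qquad\text{for all } f\in H_\nu(\mu_Y).$$ Then $$d_{W_2}(\mu_X,\mu_Y)\le\frac d2\left(\int_{\mathbb{R}^d}\|u\|^2\nu(du)\right)^{1/2}\left(U_Y\mathbb{E}\|Y\|^2+\int_{\mathbb{R}^d}\|u\|^2\nu(du)-2\mathbb{E}\|Y\|^2\right)^{1/2}.$$ Moreover, if $\mathbb{E}\|Y\|^2=\int_{\mathbb{R}^d}\|u\|^2\nu(du)$, then $$d_{W_2}(\mu_X,\mu_Y)\le\frac d2\left(\int_{\mathbb{R}^d}\|u\|^2\nu(du)\right)\sqrt{U_Y-1}.$$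
   Context: $\|\cdot\|$ and $\langle\cdot;\cdot\rangle$ are the Euclidean norm and inner product on $\mathbb{R}^d$; $S^{d-1}$ is the unit sphere and $D$ the closed unit ball. A Lévy measure is a positive Borel measure $\nu$ on $\mathbb{R}^d$ with $\nu(\{0\})=0$ and $\int(1\wedge\|u\|^2)\nu(du)<\infty$. $X\sim ID(b,A,\nu)$ means its characteristic function is $\exp\big(i\langle b;\xi\rangle-\frac12\langle\xi;A\xi\rangle+\int(e^{i\langle\xi;u\rangle}-1-i\langle\xi;u\rangle\mathbf{1}_D(u))\nu(du)\big)$; "without Gaussian component" means $A=0$. Non-degenerate means that the support of the law is not contained in a $(d-1)$-dimensional subspace of $\mathbb{R}^d$. A random vector with characteristic function $\varphi$ is self-decomposable if for every $\gamma\in(0,1)$ there is a probability measure on $\mathbb{R}^d$ with characteristic function $\xi\mapsto\varphi(\xi)/\varphi(\gamma\xi)$. Self-decomposable laws are infinitely divisible. Polar decomposition: the Lévy measure of a self-decomposable law satisfies, for Borel $B\subset\mathbb{R}^d\setminus\{0\}$, $\nu(B)=\int_{S^{d-1}}\lambda(dx)\int_0^{+\infty}\mathbf{1}_B(rx)k_x(r)\frac{dr}{r}$, with $\lambda$ a finite positive measure on $S^{d-1}$ and $k_x(r)\ge0$ measurable in $x$ and non-increasing in $r>0$. One takes $\nu\neq0$ and the normalization $\lambda(S^{d-1})=1$, $\int_0^\infty(r^2\wedge1)k_x(r)dr/r$ finite and independent of $x$, and $k_x(\cdot)$ right-continuous. The supremum over $x\in S^{d-1}$ is a $\lambda$-essential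 supremum. $\nu\ast\mu_Y$ is the convolution of the positive measures $\nu$ and $\mu_Y$; $\ll$ denotes absolute continuity. $H_\nu(\mu_Y)$ is the vector space of Borel measurable functions $f:\mathbb{R}^d\to\mathbb{R}^d$ (identified when equal $\mu_Y$-a.e.) such that $\int\|f(y)\|^2\mu_Y(dy)<\infty$ and $\int\int\|f(y+u)-f(y)\|^2\nu(du)\mu_Y(dy)<\infty$. Smooth Wasserstein distance: $M_0(h)=\sup_x|h(x)|$, and for $\ell\ge1$, $M_\ell(h)=\sup_x\|\mathbf{D}^\ell(h)(x)\|_{op}$, where $\mathbf{D}^\ell(h)(x)$ is the $\ell$-th derivative viewed as an $\ell$-multilinear form and $\|F\|_{op}=\sup\{|F(v_1,\dots,v_\ell)|:\|v_j\|=1\}$. $\mathcal{H}_r$ is the set of bounded continuous real functions on $\mathbb{R}^d$, $r$ times continuously differentiable, with $\max_{0\le\ell\le r}M_\ell(h)\le1$, and $d_{W_r}(\mu_X,\mu_Y)=\sup_{h\in\mathcal{H}_r}|\mathbb{E}h(X)-\mathbb{E}h(Y)|$. *)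

theory Defs
  imports "HOL-Probability.Probability"
begin

definition levy_measure :: "'a::euclidean_space measure \<Rightarrow> bool" where
  "levy_measure \<nu> \<longleftrightarrow>
     sets \<nu> = sets borel \<and> emeasure \<nu> {0} = 0 \<and>
     (\<integral>\<^sup>+u. ennreal (min 1 ((norm u)\<^sup>2)) \<partial>\<nu>) < \<infinity>"

definition char_fun :: "'a::euclidean_space measure \<Rightarrow> 'a \<Rightarrow> complex" where
  "char_fun \<mu> \<xi> = (\<integral>x. iexp (\<xi> \<bullet> x) \<partial>\<mu>)"

definition ID_law ::
  "(real ^ 'd::finite) measure \<Rightarrow> real ^ 'd \<Rightarrow> real ^ 'd ^ 'd \<Rightarrow> (real ^ 'd) measure \<Rightarrow> bool" where
  "ID_law \<mu> b A \<nu> \<longleftrightarrow>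
     prob_space \<mu> \<and> sets \<mu> = sets borel \<and>
     transpose A = A \<and> (\<forall>\<xi>. 0 \<le> \<xi> \<bullet> (A *v \<xi>)) \<and>
     levy_measure \<nu> \<and>
     (\<forall>\<xi>. char_fun \<mu> \<xi> =
        exp (\<i> * complex_of_real (b \<bullet> \<xi>) - complex_of_real (\<xi> \<bullet> (A *v \<xi>)) / 2
             + (\<integral>u. (iexp (\<xi> \<bullet> u) - 1
                   - \<i> * complex_of_real ((\<xi> \<bullet> u) * indicator (cball 0 1) u)) \<partial>\<nu>)))"

text \<open>
  The convention \<open>x / 0 = 0\<close> plays no role here: the condition for all \<open>\<gamma>\<close> already forces the
  characteristic function of a law not to vanish anywhere.
\<close>

definition self_decomposable :: "'a::euclidean_space measure \<Rightarrow> bool" where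
  "self_decomposable \<mu> \<longleftrightarrow>
     (\<forall>\<gamma>\<in>{0<..<1}. \<exists>\<rho> :: 'a measure. prob_space \<rho> \<and> sets \<rho> = sets borel \<and>
        (\<forall>\<xi>. char_fun \<rho> \<xi> = char_fun \<mu> \<xi> / char_fun \<mu> (\<gamma> *\<^sub>R \<xi>)))"

definition measure_support :: "'a::euclidean_space measure \<Rightarrow> 'a set" where
  "measure_support \<mu> = {x. \<forall>U. open U \<longrightarrow> x \<in> U \<longrightarrow> emeasure \<mu> U \<noteq> 0}"

definition nondegenerate :: "'a::euclidean_space measure \<Rightarrow> bool" where
  "nondegenerate \<mu> \<longleftrightarrow>
     \<not> (\<exists>V. subspace V \<and> dim V = DIM('a) - 1 \<and> measure_support \<mu> \<subseteq> V)"

text \<open>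
  The values \<open>k x r\<close> for \<open>r \<le> 0\<close> or \<open>x\<close> off the
  unit sphere are irrelevant.
\<close>

definition polar_decomposition ::
  "'a::euclidean_space measure \<Rightarrow> 'a measure \<Rightarrow> ('a \<Rightarrow> real \<Rightarrow> real) \<Rightarrow> bool" where
  "polar_decomposition \<nu> \<Lambda> k \<longleftrightarrow>
     emeasure \<nu> UNIV \<noteq> 0 \<and>
     sets \<Lambda> = sets (restrict_space borel (sphere 0 1)) \<and> prob_space \<Lambda> \<and>
     (\<forall>r>0. (\<lambda>x. k x r) \<in> borel_measurable \<Lambda>) \<and>
     (\<forall>x\<in>sphere 0 1. (\<forall>r>0. 0 \<le> k x r) \<and>
        antimono_on {0<..} (k x) \<and>
        (\<forall>r>0. continuous (at_right r) (k x))) \<and>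
     (\<exists>c<\<infinity>. \<forall>x\<in>sphere 0 1.
        (\<integral>\<^sup>+r. ennreal (min (r\<^sup>2) 1 * k x r / r) * indicator {0<..} r \<partial>lborel) = c) \<and>
     (\<forall>B\<in>sets borel. B \<subseteq> - {0} \<longrightarrow>
        emeasure \<nu> B =
          (\<integral>\<^sup>+x. (\<integral>\<^sup>+r. indicator B (r *\<^sub>R x) * ennreal (k x r / r) * indicator {0<..} r \<partial>lborel) \<partial>\<Lambda>))"

text \<open>
  Functions rather than classes modulo equality almost everywhere.  When the convolution of
  \<open>\<nu>\<close> and \<open>\<mu>\<close> is absolutely continuous with respect to \<open>\<mu>\<close>, both this space and
  the inequality below are invariant under changing a function on a \<open>\<mu>\<close>-null set.
\<close>

definition H_space :: "'a::euclidean_space measure \<Rightarrow> 'a measure \<Rightarrow> ('a \<Rightarrow> 'a) set" where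
  "H_space \<nu> \<mu> = {f \<in> borel_measurable borel.
     (\<integral>\<^sup>+y. ennreal ((norm (f y))\<^sup>2) \<partial>\<mu>) < \<infinity> \<and>
     (\<integral>\<^sup>+y. (\<integral>\<^sup>+u. ennreal ((norm (f (y + u) - f y))\<^sup>2) \<partial>\<nu>) \<partial>\<mu>) < \<infinity>}"

definition poincare_inequality :: "'a::euclidean_space measure \<Rightarrow> 'a measure \<Rightarrow> real \<Rightarrow> bool" where
  "poincare_inequality \<nu> \<mu> U \<longleftrightarrow>
     (\<forall>f\<in>H_space \<nu> \<mu>.
        (\<integral>\<^sup>+y. ennreal ((norm (f y - (\<integral>z. f z \<partial>\<mu>)))\<^sup>2) \<partial>\<mu>)
        \<le> ennreal U * (\<integral>\<^sup>+y. (\<integral>\<^sup>+u. ennreal ((norm (f (y + u) - f y))\<^sup>2) \<partial>\<nu>) \<partial>\<mu>))"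

text \<open>
  \<open>higher_deriv h vs x\<close> is the \<open>length vs\<close>-th derivative of \<open>h\<close> at \<open>x\<close>, as a
  multilinear form evaluated at the vectors in \<open>vs\<close>.  Since the dimension is finite,
  \<open>h\<close> is of class \<open>C\<^sup>r\<^sup>+\<^sup>1\<close> iff it is differentiable and the function \<open>x \<mapsto> Dh(x)v\<close> is of
  class \<open>C\<^sup>r\<close> for every \<open>v\<close>; this is the recursion used in \<open>C_diff\<close>.
\<close>

primrec higher_deriv :: "('a::euclidean_space \<Rightarrow> real) \<Rightarrow> 'a list \<Rightarrow> 'a \<Rightarrow> real" where
  "higher_deriv h [] = h"
| "higher_deriv h (v # vs) = (\<lambda>x. frechet_derivative (higher_deriv h vs) (at x) v)"

primrec C_diff :: "nat \<Rightarrow> ('a::euclidean_space \<Rightarrow> real) \<Rightarrow> bool" where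
  "C_diff 0 h \<longleftrightarrow> continuous_on UNIV h"
| "C_diff (Suc r) h \<longleftrightarrow>
     (\<forall>x. h differentiable (at x)) \<and> (\<forall>v. C_diff r (\<lambda>x. frechet_derivative h (at x) v))"

text \<open>For \<open>l = 0\<close> the only list is empty, so that \<open>M_norm 0 h\<close> is the supremum of \<open>\<bar>h\<bar>\<close>.\<close>

definition M_norm :: "nat \<Rightarrow> ('a::euclidean_space \<Rightarrow> real) \<Rightarrow> ereal" where
  "M_norm l h =
     (SUP x. SUP vs\<in>{vs. length vs = l \<and> (\<forall>v\<in>set vs. norm v = 1)}. ereal \<bar>higher_deriv h vs x\<bar>)"

definition test_functions :: "nat \<Rightarrow> ('a::euclidean_space \<Rightarrow> real) set" where
  "test_functions r =
     {h. bounded (range h) \<and> continuous_on UNIV h \<and> C_diff r h \<and> (MAX l\<in>{0..r}. M_norm l h) \<le> 1}"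

text \<open>
  For probability measures the real supremum is over a nonempty set bounded by \<open>2\<close>.
\<close>

definition smooth_wasserstein ::
  "nat \<Rightarrow> 'a::euclidean_space measure \<Rightarrow> 'a measure \<Rightarrow> real" where
  "smooth_wasserstein r \<mu> \<mu>' =
     (SUP h\<in>test_functions r. \<bar>(\<integral>x. h x \<partial>\<mu>) - (\<integral>x. h x \<partial>\<mu>')\<bar>)"

end

(*
  Write E(f, g) for the expectation of the integral of <f(Y+u) - f(Y); g(Y+u) - g(Y)> with respect
  to nu(du), and l(g) = E<Y; g(Y)>. By the Poincare inequality and E Y = 0, l(f)^2 <= U E|Y|^2 E(f, f),
  so that on the span of the identity and g, the functional l is represented by a vector tau of
  squared norm at most U E|Y|^2 (a Stein kernel; this plane suffices, so no completeness of H is needed).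
  Hence |l(g) - E(id, g)| <= E(g, g)^(1/2) |tau - id|, and
  |tau - id|^2 <= U E|Y|^2 + E(id, id) - 2 E|Y|^2, where E(id, id) is the second moment of nu.

  Self-decomposability gives independent Z_c with law(cX + Z_c) = law(X), 0 < c < 1. The curve
  c |-> E h(cY + Z_c) joins E h(X) (c = 0) to E h(Y) (c = 1). When h is a trigonometric
  polynomial, differentiating characteristic functions shows that its derivative is l(g) - E(id, g) with
  g(y) = E (grad h)(cy + Z_c), which is cL-Lipschitz if grad h is L-Lipschitz. Integrating over c
  gives the bound with the factor 1/2. General test functions are limits of trigonometric polynomials
  whose gradients are (1 + o(1))-Lipschitz.
*)
theory Submission
  imports Defs
begin

section \<open>Test functions and second differences\<close>

text \<open>Trigonometric polynomials fit because Z_c is known only through its characteristic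
  function. At frequency \<xi> the curve is the product of the characteristic function of Y at
  c\<xi> with exp(\<psi>(\<xi>) - \<psi>(c\<xi>)), where \<psi> is \<open>levy_exponent\<close>; the
  two terms of the product rule become the two terms of l(g) - E(id, g). The obstacle is to
  approximate a test function without losing the Lipschitz constant of its gradient, about which
  uniform closeness says nothing. The constant is therefore carried by second differences, which
  pass to averages and to pointwise limits. The identity is admissible in the Poincare inequality
  once \<nu> has a finite second moment, which is extracted from that of X. Then <tau; id> = l(id) =
  E|Y|^2, which is where the term - 2 E|Y|^2 comes from. Gradients are measured in the Euclidean
  norm and second derivatives as bilinear forms, so no dimensional factor arises on the way: the
  constant obtained is 1/2, and d/2 follows from 1 <= d.\<close>

lemma nonneg_quadratic_form_discriminant:
  fixes r s t :: real
  assumes "\<And>a b. 0 \<le> a\<^sup>2 * r + 2 * a * b * s + b\<^sup>2 * t"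
  shows "s\<^sup>2 \<le> r * t \<and> 0 \<le> r \<and> 0 \<le> t"
proof -
  have r: "0 \<le> r" using assms[of 1 0] by simp
  have t: "0 \<le> t" using assms[of 0 1] by simp
  have "s\<^sup>2 \<le> r * t"
  proof (cases "t = 0")
    case True
    have "s = 0"
    proof (rule ccontr)
      assume "s \<noteq> 0"
      \<comment> \<open>For \<open>t = 0\<close> the form at \<open>(1, b)\<close> is
        \<open>r + 2 * b * s\<close>, affine in \<open>b\<close>; this \<open>b\<close> gives it the
        value -1.\<close>
      then show False using assms[of 1 "- (r + 1) / (2 * s)"] True r by (simp add: field_simps)
    qed
    then show ?thesis using True by simp
  next
    case False
    then have "t > 0" using t by simp
    \<comment> \<open>The value of the form at \<open>(t, - s)\<close>.\<close>
    have "0 \<le> t * (r * t - s\<^sup>2)"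
      using assms[of t "- s"] by (simp add: power2_eq_square algebra_simps)
    then show ?thesis using \<open>t > 0\<close> by (simp add: zero_le_mult_iff)
  qed
  then show ?thesis using r t by simp
qed

text \<open>
  A linear functional of norm at most \<open>sqrt K\<close> on a plane is represented by a vector \<open>\<tau>\<close> of norm at most
  \<open>sqrt K\<close>; the conclusion is the Cauchy--Schwarz inequality for \<open>\<tau> - v\<close> against \<open>w\<close>, where
  \<open>A = \<langle>v, v\<rangle>\<close>, \<open>q = \<langle>v, w\<rangle>\<close>, \<open>G = \<langle>w, w\<rangle>\<close>, \<open>l = \<langle>\<tau>, v\<rangle>\<close>, \<open>m = \<langle>\<tau>, w\<rangle>\<close>.
\<close>

lemma quadratic_form_functional_bound:
  fixes A q G K l m :: real
  assumes K: "0 \<le> K"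
    and pos: "\<And>a b. 0 \<le> a\<^sup>2 * A + 2 * a * b * q + b\<^sup>2 * G"
    and dom: "\<And>a b. (a * l + b * m)\<^sup>2 \<le> K * (a\<^sup>2 * A + 2 * a * b * q + b\<^sup>2 * G)"
  shows "(m - q)\<^sup>2 \<le> G * (K - 2 * l + A)" and "0 \<le> K - 2 * l + A"
proof -
  have AG: "q\<^sup>2 \<le> A * G" "0 \<le> A" "0 \<le> G" using nonneg_quadratic_form_discriminant[of A q G] pos by auto
  have *: "0 \<le> K - 2 * l + A \<and> (m - q)\<^sup>2 \<le> G * (K - 2 * l + A)"
  proof (cases "K = 0")
    case True
    have "l = 0" "m = 0" using dom[of 1 0] dom[of 0 1] True by auto
    then show ?thesis using True AG by (simp add: mult.commute)
  next
    case False
    then have K: "K > 0" using K by simp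
    \<comment> \<open>In the extremal case where \<tau> has squared norm \<open>K\<close>, these are
      the inner products of the parts of \<open>v\<close> and \<open>w\<close> orthogonal to \<tau>.
      By \<open>dom\<close> their form is still nonnegative.\<close>
    define n11 where "n11 = A - l\<^sup>2 / K"
    define n12 where "n12 = q - l * m / K"
    define n22 where "n22 = G - m\<^sup>2 / K"
    have N: "n12\<^sup>2 \<le> n11 * n22 \<and> 0 \<le> n11 \<and> 0 \<le> n22"
    proof (rule nonneg_quadratic_form_discriminant)
      fix a b
      have "a\<^sup>2 * n11 + 2 * a * b * n12 + b\<^sup>2 * n22
          = (K * (a\<^sup>2 * A + 2 * a * b * q + b\<^sup>2 * G) - (a * l + b * m)\<^sup>2) / K"
        using K unfolding n11_def n12_def n22_def by (simp add: field_simps power2_eq_square)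
      then show "0 \<le> a\<^sup>2 * n11 + 2 * a * b * n12 + b\<^sup>2 * n22"
        using dom[of a b] K by simp
    qed
    \<comment> \<open>The coefficient of \<tau> in \<tau> - v. Splitting off the direction \<tau>
      then gives \<open>R\<close> for the squared norm of \<tau> - v and \<open>m * s - n12\<close>
      for its product with \<open>w\<close>.\<close>
    define s where "s = 1 - l / K"
    have R: "K - 2 * l + A = K * s\<^sup>2 + n11"
      using K unfolding n11_def s_def by (simp add: field_simps power2_eq_square)
    have m: "m - q = m * s - n12"
      using K unfolding n12_def s_def by (simp add: field_simps)
    have G: "G = m\<^sup>2 / K + n22" unfolding n22_def by simp
    have "\<bar>n12\<bar> \<le> sqrt n11 * sqrt n22"
      using N by (metis real_le_rsqrt real_sqrt_mult power2_abs)
    then have c1: "- 2 * m * s * n12 \<le> 2 * \<bar>m\<bar> * \<bar>s\<bar> * (sqrt n11 * sqrt n22)"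
      by (smt (verit, ccfv_SIG) abs_ge_minus_self abs_mult mult.assoc mult_left_mono abs_ge_zero mult_minus_left
          minus_mult_commute mult_nonneg_nonneg)
    \<comment> \<open>Cauchy--Schwarz for the sum of the component along \<tau> and the orthogonal
      one: this square absorbs the mixed term bounded in \<open>c1\<close>.\<close>
    have "0 \<le> (\<bar>m\<bar> * sqrt n11 / sqrt K - \<bar>s\<bar> * sqrt K * sqrt n22)\<^sup>2" by simp
    also have "\<dots> = m\<^sup>2 / K * n11 + s\<^sup>2 * K * n22 - 2 * \<bar>m\<bar> * \<bar>s\<bar> * (sqrt n11 * sqrt n22)"
      using K N by (simp add: power2_diff power_mult_distrib power_divide)
    finally have "(m * s - n12)\<^sup>2 \<le> (m\<^sup>2 / K + n22) * (K * s\<^sup>2 + n11)"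
      using c1 N K by (simp add: power2_diff power_mult_distrib algebra_simps)
    then show ?thesis using R m G N K by simp
  qed
  then show "0 \<le> K - 2 * l + A" and "(m - q)\<^sup>2 \<le> G * (K - 2 * l + A)" by auto
qed

section \<open>Second differences of functions with bounded second derivative\<close>

text \<open>
  For differentiable \<open>h\<close> this says that the gradient is \<open>L\<close>-Lipschitz, but in a form that visibly passes
  to averages of translates and to pointwise limits.
\<close>

definition second_diff_bound :: "real \<Rightarrow> ('a::euclidean_space \<Rightarrow> real) \<Rightarrow> bool" where
  "second_diff_bound L h \<longleftrightarrow>
     (\<forall>x a b. \<bar>h (x + a + b) - h (x + a) - h (x + b) + h x\<bar> \<le> L * norm a * norm b)"

lemma second_diff_boundD:
  "second_diff_bound L h \<Longrightarrow>
    \<bar>h (x + a + b) - h (x + a) - h (x + b) + h x\<bar> \<le> L * norm a * norm b"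
  by (simp add: second_diff_bound_def)

text \<open>Mean value theorem on the segment from \<open>x\<close> to \<open>x + a\<close>. The
  bound is asked on unit vectors only, which is the form in which \<open>M_norm\<close> supplies
  it.\<close>

lemma frechet_derivative_bound:
  fixes f :: "'a::euclidean_space \<Rightarrow> real"
  assumes diff: "\<And>x. (f has_derivative f' x) (at x)"
    and bound: "\<And>x v. norm v = 1 \<Longrightarrow> \<bar>f' x v\<bar> \<le> B"
  shows "\<bar>f (x + a) - f x\<bar> \<le> B * norm a"
proof (cases "a = 0")
  case False
  have "\<exists>t\<in>{0<..<1}. f (x + 1 *\<^sub>R a) - f (x + 0 *\<^sub>R a) = f' (x + t *\<^sub>R a) ((1 - 0) *\<^sub>R a)"
  proof (rule bexE[OF mvt_simple[of 0 1 "\<lambda>t. f (x + t *\<^sub>R a)" "\<lambda>t s. f' (x + t *\<^sub>R a) (s *\<^sub>R a)"]])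
    show "((\<lambda>t. f (x + t *\<^sub>R a)) has_derivative (\<lambda>s. f' (x + t *\<^sub>R a) (s *\<^sub>R a))) (at t within {0..1})"
      for t
      by (rule has_derivative_compose[OF _ diff]) (auto intro!: derivative_eq_intros)
  qed auto
  then obtain t where t: "f (x + a) - f x = f' (x + t *\<^sub>R a) a" by auto
  have lin: "linear (f' (x + t *\<^sub>R a))" using diff has_derivative_linear by blast
  have "f' (x + t *\<^sub>R a) a = norm a * f' (x + t *\<^sub>R a) (a /\<^sub>R norm a)"
    using False by (simp add: linear_scale[OF lin])
  then show ?thesis using t bound[of "a /\<^sub>R norm a" "x + t *\<^sub>R a"] False
    by (simp add: abs_mult mult.commute mult_left_mono)
qed simp

lemma higher_deriv_le:
  assumes "M_norm l h \<le> 1" "length vs = l" "\<And>v. v \<in> set vs \<Longrightarrow> norm v = 1"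
  shows "\<bar>higher_deriv h vs x\<bar> \<le> 1"
proof -
  have "ereal \<bar>higher_deriv h vs x\<bar> \<le> M_norm l h"
    unfolding M_norm_def
    by (rule SUP_upper2[OF UNIV_I], rule SUP_upper) (use assms in auto)
  then show ?thesis using assms(1) by (metis ereal_less_eq(3) one_ereal_def order_trans)
qed

text \<open>The mean value bound is applied to \<open>h\<close>, to its directional derivatives, and
  finally to the difference of \<open>h\<close> and a translate of it. The second derivative enters
  only as a bilinear form on pairs of unit vectors, so the constant is 1 in every dimension.\<close>

lemma test_functions_2D:
  assumes h: "h \<in> test_functions 2"
  shows "\<bar>h x\<bar> \<le> 1" and "\<bar>h (x + a) - h x\<bar> \<le> norm a" and "second_diff_bound 1 h"
proof -
  have M: "M_norm l h \<le> 1" if "l \<in> {0..2}" for l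
  proof -
    have "M_norm l h \<le> (MAX l\<in>{0..2}. M_norm l h)" using that by (intro Max_ge) auto
    also have "\<dots> \<le> 1" using h unfolding test_functions_def by blast
    finally show ?thesis .
  qed
  show "\<bar>h x\<bar> \<le> 1" using higher_deriv_le[of 0 h "[]" x] M[of 0] by simp
  let ?D = "\<lambda>x. frechet_derivative h (at x)"
  have C: "C_diff (Suc (Suc 0)) h" using h unfolding test_functions_def by (simp add: numeral_2_eq_2)
  have D: "(h has_derivative ?D x) (at x)" for x
    using C by (simp add: frechet_derivative_works[symmetric])
  have D2: "((\<lambda>x. ?D x v) has_derivative frechet_derivative (\<lambda>x. ?D x v) (at x)) (at x)" for x v
    using C by (simp add: frechet_derivative_works[symmetric])
  show "\<bar>h (x + a) - h x\<bar> \<le> norm a"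
    using frechet_derivative_bound[OF D, of 1 x a] higher_deriv_le[of 1 h "[_]"] M[of 1] by simp
  have L: "\<bar>?D (x + b) v - ?D x v\<bar> \<le> norm b" if "norm v = 1" for x b v
  proof -
    have "\<bar>?D (x + b) v - ?D x v\<bar> \<le> 1 * norm b"
    proof (rule frechet_derivative_bound[OF D2])
      fix x w :: 'a assume "norm w = 1"
      then show "\<bar>frechet_derivative (\<lambda>x. ?D x v) (at x) w\<bar> \<le> 1"
        using higher_deriv_le[of 2 h "[w, v]" x] M[of 2] that by auto
    qed
    then show ?thesis by simp
  qed
  show "second_diff_bound 1 h"
    unfolding second_diff_bound_def
  proof (intro allI)
    fix x a b :: 'a
    have d: "((\<lambda>x. h (x + b) - h x) has_derivative (\<lambda>v. ?D (x + b) v - ?D x v)) (at x)" for x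
    proof (intro has_derivative_diff D)
      have "((\<lambda>x. x + b) has_derivative (\<lambda>v. v)) (at x)" by (auto intro!: derivative_eq_intros)
      from has_derivative_compose[OF this D[of "x + b"]]
      show "((\<lambda>x. h (x + b)) has_derivative ?D (x + b)) (at x)" .
    qed
    have "\<bar>(h (x + a + b) - h (x + a)) - (h (x + b) - h x)\<bar> \<le> norm b * norm a"
      by (rule frechet_derivative_bound[OF d]) (rule L)
    then show "\<bar>h (x + a + b) - h (x + a) - h (x + b) + h x\<bar> \<le> 1 * norm a * norm b"
      by (simp add: algebra_simps)
  qed
qed

text \<open>Shows that the supremum in \<open>smooth_wasserstein\<close> is over a nonempty set, as
  a bound on a conditional supremum requires.\<close>

lemma zero_in_test_functions: "(\<lambda>_. 0) \<in> test_functions r"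
proof -
  have z: "higher_deriv (\<lambda>_::'a. 0::real) vs = (\<lambda>_. 0)" for vs
    by (induction vs) (auto simp: frechet_derivative_const)
  have C: "C_diff s (\<lambda>_::'a. 0::real)" for s
    by (induction s) (auto simp: frechet_derivative_const)
  have "M_norm l (\<lambda>_::'a. 0::real) \<le> 1" for l
    unfolding M_norm_def z by (intro SUP_least) auto
  then show ?thesis unfolding test_functions_def using C by (auto simp: Max_le_iff)
qed

section \<open>Approximation by trigonometric polynomials\<close>

lemma lborel_integral_shift:
  fixes g :: "'a::euclidean_space \<Rightarrow> real"
  assumes [measurable]: "g \<in> borel_measurable borel"
  shows "(\<integral>z. g (z - a) \<partial>lborel) = (\<integral>z. g z \<partial>lborel)"
proof -
  have "(\<integral>z. g z \<partial>lborel) = (\<integral>z. g z \<partial>distr lborel borel ((+) (- a)))"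
    by (simp add: lborel_distr_plus)
  also have "\<dots> = (\<integral>z. g (z - a) \<partial>lborel)"
    by (subst integral_distr) (auto simp: algebra_simps)
  finally show ?thesis by simp
qed

text \<open>The density is the normalized tent \<open>max 0 (\<delta> - norm z)\<close>. A shift of
  \<open>f\<close> is moved onto the density, whose Lipschitz constant then pays for it; so
  \<open>f\<close> need only be bounded and measurable, and \<open>C\<close> depends on
  \<open>\<delta>\<close> alone.\<close>

lemma exists_smoothing_measure:
  assumes "0 < \<delta>"
  obtains \<kappa> :: "'a::euclidean_space measure" and C where
    "prob_space \<kappa>" "sets \<kappa> = sets borel" "AE z in \<kappa>. norm z \<le> \<delta>" "0 \<le> C"
    "\<And>f B x a. f \<in> borel_measurable borel \<Longrightarrow> (\<And>x. \<bar>f x\<bar> \<le> B) \<Longrightarrow>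
       \<bar>(\<integral>z. f (x + a + z) \<partial>\<kappa>) - (\<integral>z. f (x + z) \<partial>\<kappa>)\<bar> \<le> C * B * norm a"
proof -
  define k :: "'a \<Rightarrow> real" where "k z = max 0 (\<delta> - norm z)" for z
  have k_meas[measurable]: "k \<in> borel_measurable borel" unfolding k_def by measurable
  have fin: "emeasure lborel (cball (0::'a) r) < \<infinity>" for r by (rule emeasure_lborel_cball_finite)
  have ind: "integrable lborel (indicator (cball (0::'a) r) :: 'a \<Rightarrow> real)" for r
    using fin by (intro integrable_real_indicator) auto
  have k_int: "integrable lborel k"
    by (rule Bochner_Integration.integrable_bound[OF integrable_mult_right[OF ind[of \<delta>], of \<delta>]])
       (auto simp: k_def indicator_def assms less_imp_le)
  define I where "I = (\<integral>z. k z \<partial>lborel)"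
  define V where "V = measure lborel (cball (0::'a) \<delta>)"
  \<comment> \<open>On the ball of radius \<open>\<delta> / 2\<close> the tent is at least
    \<open>\<delta> / 2\<close>, so its integral \<open>I\<close> is positive and can be divided
    by.\<close>
  have "0 < \<delta> / 2 * measure lborel (cball (0::'a) (\<delta> / 2))"
  proof -
    have "0 < measure lborel (cball (0::'a) (\<delta> / 2))"
      using assms content_cball_pos[of "\<delta> / 2" "0::'a"] by simp
    then show ?thesis using assms by simp
  qed
  also have "\<dots> = (\<integral>z. \<delta> / 2 * indicator (cball (0::'a) (\<delta> / 2)) z \<partial>lborel)" by simp
  also have "\<dots> \<le> I" unfolding I_def
    by (intro integral_mono k_int integrable_mult_right ind) (auto simp: k_def indicator_def max_def)
  finally have I: "0 < I" .
  define K where "K z = k z / I" for z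
  have K_meas[measurable]: "K \<in> borel_measurable borel" unfolding K_def by measurable
  have K0: "0 \<le> K z" for z unfolding K_def k_def using I by simp
  have K_int: "integrable lborel K" unfolding K_def using k_int by simp
  have K1: "(\<integral>z. K z \<partial>lborel) = 1" unfolding K_def using I by (simp add: I_def[symmetric])
  have K_supp: "K z = 0" if "norm z > \<delta>" for z using that unfolding K_def k_def by simp
  \<comment> \<open>The density has Lipschitz constant \<open>1 / I\<close>, and the difference
    vanishes unless one of the two arguments lies in the ball. Integrating the two indicators yields
    \<open>C = 2 * V / I\<close>.\<close>
  have K_lip: "\<bar>K (z - a) - K z\<bar> \<le> norm a / I * (indicator (cball 0 \<delta>) (z - a) + indicator (cball 0 \<delta>) z)"
    for z a
  proof -
    have n: "\<bar>norm (z - a) - norm z\<bar> \<le> norm a"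
      using norm_triangle_ineq3[of "z - a" z] by simp
    have "\<bar>k (z - a) - k z\<bar> \<le> norm a * (indicator (cball 0 \<delta>) (z - a) + indicator (cball 0 \<delta>) z)"
      using n unfolding k_def by (auto simp: indicator_def max_def split: if_splits)
    then show ?thesis using I unfolding K_def by (simp add: diff_divide_distrib[symmetric] divide_right_mono)
  qed
  define \<kappa> where "\<kappa> = density lborel (\<lambda>z. ennreal (K z))"
  define C where "C = 2 * V / I"
  show ?thesis
  proof (rule that[of \<kappa> C])
    show "prob_space \<kappa>"
    proof
      show "emeasure \<kappa> (space \<kappa>) = 1"
        unfolding \<kappa>_def using nn_integral_eq_integral[OF K_int] K0 K1 by (simp add: emeasure_density)
    qed
    show "sets \<kappa> = sets borel" unfolding \<kappa>_def by simp
    show "AE z in \<kappa>. norm z \<le> \<delta>" unfolding \<kappa>_def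
      by (subst AE_density) (auto intro!: AE_I2 simp: K_supp not_le[symmetric] intro: ccontr)
    show "0 \<le> C" unfolding C_def V_def using I by simp
    fix f :: "'a \<Rightarrow> real" and B x a
    assume [measurable]: "f \<in> borel_measurable borel" and B: "\<And>x. \<bar>f x\<bar> \<le> B"
    have B0: "0 \<le> B" using B[of 0] by linarith
    have i1: "integrable lborel (\<lambda>z. K z * f (y + z))" for y
      by (rule Bochner_Integration.integrable_bound[OF integrable_mult_right[OF K_int, of B]])
         (use mult_left_mono[OF B K0] B0 in \<open>auto simp: abs_mult K0 mult.commute\<close>)
    have e: "(\<integral>z. f (y + z) \<partial>\<kappa>) = (\<integral>z. K z * f (y + z) \<partial>lborel)" for y
      unfolding \<kappa>_def by (subst integral_density) (auto simp: K0)
    have "(\<integral>z. K z * f (x + a + z) \<partial>lborel) = (\<integral>z. K (z - a) * f (x + z) \<partial>lborel)"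
      by (subst lborel_integral_shift[where a = a, symmetric]) (auto simp: algebra_simps)
    moreover have i2: "integrable lborel (\<lambda>z. K (z - a) * f (x + z))"
    proof -
      have "integrable (distr lborel borel ((+) (- a))) (\<lambda>z. K z * f (x + a + z))"
        using i1 by (simp add: lborel_distr_plus)
      then show ?thesis by (subst (asm) integrable_distr_eq) (auto simp: algebra_simps)
    qed
    have [measurable]: "cball (0::'a) \<delta> \<in> sets borel" by simp
    have i3: "integrable lborel (\<lambda>z. indicator (cball 0 \<delta>) (z - a) :: real)"
    proof -
      have "integrable (distr lborel borel ((+) (- a))) (indicator (cball 0 \<delta>) :: 'a \<Rightarrow> real)"
        using ind by (simp add: lborel_distr_plus)
      then show ?thesis by (subst (asm) integrable_distr_eq) (auto simp: algebra_simps)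
    qed
    have s: "(\<integral>z. indicator (cball 0 \<delta>) (z - a) \<partial>lborel) = V"
      by (subst lborel_integral_shift) (auto simp: V_def)
    ultimately have "(\<integral>z. f (x + a + z) \<partial>\<kappa>) - (\<integral>z. f (x + z) \<partial>\<kappa>)
        = (\<integral>z. (K (z - a) - K z) * f (x + z) \<partial>lborel)"
      unfolding e using i1 i2 by (simp add: left_diff_distrib)
    also have "\<bar>\<dots>\<bar> \<le> (\<integral>z. norm a / I * (indicator (cball 0 \<delta>) (z - a) + indicator (cball 0 \<delta>) z) * B \<partial>lborel)"
    proof (rule integral_abs_bound_integral)
      show "integrable lborel (\<lambda>z. (K (z - a) - K z) * f (x + z))"
        using i1 i2 by (simp add: left_diff_distrib)
      show "integrable lborel (\<lambda>z. norm a / I * (indicator (cball 0 \<delta>) (z - a) + indicator (cball 0 \<delta>) z) * B)"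
        by (intro integrable_mult_left integrable_mult_right Bochner_Integration.integrable_add i3 ind)
      show "\<bar>(K (z - a) - K z) * f (x + z)\<bar>
          \<le> norm a / I * (indicator (cball 0 \<delta>) (z - a) + indicator (cball 0 \<delta>) z) * B" for z
        unfolding abs_mult by (intro mult_mono K_lip B) (use I in auto)
    qed
    also have "\<dots> = C * B * norm a"
      by (subst integral_mult_left_zero, subst integral_mult_right_zero,
          subst Bochner_Integration.integral_add[OF i3 ind])
         (auto simp: s C_def V_def[symmetric])
    finally show "\<bar>(\<integral>z. f (x + a + z) \<partial>\<kappa>) - (\<integral>z. f (x + z) \<partial>\<kappa>)\<bar> \<le> C * B * norm a" .
  qed
qed

definition smoothed :: "'a::euclidean_space measure \<Rightarrow> ('a \<Rightarrow> real) \<Rightarrow> 'a \<Rightarrow> real" where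
  "smoothed \<kappa> f x = (\<integral>z. f (x + z) \<partial>\<kappa>)"

context
  fixes \<kappa> :: "'a::euclidean_space measure"
  assumes prob: "prob_space \<kappa>" and sets_\<kappa>[measurable_cong]: "sets \<kappa> = sets borel"
begin

interpretation prob_space \<kappa> by (rule prob)

lemma integrable_shift_bounded:
  fixes f :: "'a \<Rightarrow> 'b::{banach,second_countable_topology}"
  assumes "f \<in> borel_measurable borel" "\<And>x. norm (f x) \<le> B"
  shows "integrable \<kappa> (\<lambda>z. f (x + z))"
  using assms by (intro integrable_const_bound[of _ B]) auto

lemma smoothed_measurable:
  assumes [measurable]: "f \<in> borel_measurable borel"
  shows "smoothed \<kappa> f \<in> borel_measurable borel"
  unfolding smoothed_def by measurable

lemma smoothed_bound:
  assumes "f \<in> borel_measurable borel" "\<And>x. \<bar>f x\<bar> \<le> B"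
  shows "\<bar>smoothed \<kappa> f x\<bar> \<le> B"
proof -
  have "\<bar>\<integral>z. f (x + z) \<partial>\<kappa>\<bar> \<le> (\<integral>z. B \<partial>\<kappa>)"
    by (rule integral_abs_bound_integral)
       (use assms integrable_shift_bounded[of f B] in auto)
  then show ?thesis by (simp add: smoothed_def prob_space)
qed

lemma smoothed_add:
  assumes "f \<in> borel_measurable borel" "\<And>x. \<bar>f x\<bar> \<le> B"
    and "g \<in> borel_measurable borel" "\<And>x. \<bar>g x\<bar> \<le> B'"
  shows "smoothed \<kappa> (\<lambda>x. f x + g x) = (\<lambda>x. smoothed \<kappa> f x + smoothed \<kappa> g x)"
  unfolding smoothed_def
  using integrable_shift_bounded[of f B] integrable_shift_bounded[of g B'] assms by auto

lemma second_diff_bound_smoothed: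
  assumes f: "f \<in> borel_measurable borel" "\<And>x. \<bar>f x\<bar> \<le> B" and L: "second_diff_bound L f"
  shows "second_diff_bound L (smoothed \<kappa> f)"
  unfolding second_diff_bound_def
proof (intro allI)
  fix x a b
  have i: "integrable \<kappa> (\<lambda>z. f (y + z))" for y
    using integrable_shift_bounded[of f B] f by auto
  have "smoothed \<kappa> f (x + a + b) - smoothed \<kappa> f (x + a) - smoothed \<kappa> f (x + b) + smoothed \<kappa> f x
      = (\<integral>z. f (x + a + b + z) - f (x + a + z) - f (x + b + z) + f (x + z) \<partial>\<kappa>)"
    unfolding smoothed_def using i by simp
  also have "\<bar>\<dots>\<bar> \<le> (\<integral>z. L * norm a * norm b \<partial>\<kappa>)"
  proof (rule integral_abs_bound_integral)
    show "\<bar>f (x + a + b + z) - f (x + a + z) - f (x + b + z) + f (x + z)\<bar> \<le> L * norm a * norm b" for z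
      using second_diff_boundD[OF L, of "x + z" a b] by (simp add: algebra_simps)
  qed (use i in auto)
  finally show "\<bar>smoothed \<kappa> f (x + a + b) - smoothed \<kappa> f (x + a) - smoothed \<kappa> f (x + b) + smoothed \<kappa> f x\<bar>
      \<le> L * norm a * norm b" by (simp add: prob_space)
qed

text \<open>Each averaging turns one difference into a factor \<open>C\<close>: the first makes the
  increment \<open>w\<close> in direction \<open>b\<close> small, and the second does the same for
  the increment of the average of \<open>w\<close> in direction \<open>a\<close>. Only the supremum
  bound \<open>B\<close> of \<open>f\<close> enters.\<close>

lemma second_diff_bound_smoothed_twice:
  assumes f: "f \<in> borel_measurable borel" "\<And>x. \<bar>f x\<bar> \<le> B"
    and C: "\<And>f B x a. f \<in> borel_measurable borel \<Longrightarrow> (\<And>x. \<bar>f x\<bar> \<le> B) \<Longrightarrow>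
       \<bar>(\<integral>z. f (x + a + z) \<partial>\<kappa>) - (\<integral>z. f (x + z) \<partial>\<kappa>)\<bar> \<le> C * B * norm a"
  shows "second_diff_bound (C * C * B) (smoothed \<kappa> (smoothed \<kappa> f))"
  unfolding second_diff_bound_def
proof (intro allI)
  fix x a b
  let ?f = "smoothed \<kappa> f"
  have [measurable]: "?f \<in> borel_measurable borel" using f smoothed_measurable by auto
  have i: "integrable \<kappa> (\<lambda>z. ?f (y + z))" for y
    using integrable_shift_bounded[of ?f B] smoothed_bound f by auto
  define w where "w y = ?f (y + b) - ?f y" for y
  have w: "\<bar>w y\<bar> \<le> C * B * norm b" for y
    unfolding w_def smoothed_def using C f by blast
  have "\<bar>(\<integral>z. w (x + a + z) \<partial>\<kappa>) - (\<integral>z. w (x + z) \<partial>\<kappa>)\<bar> \<le> C * (C * B * norm b) * norm a"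
    by (rule C) (use w in \<open>auto simp: w_def\<close>)
  moreover have w': "(\<integral>z. w (y + z) \<partial>\<kappa>) = smoothed \<kappa> ?f (y + b) - smoothed \<kappa> ?f y" for y
    unfolding w_def smoothed_def[of _ ?f]
    using i[of "y + b"] i[of y] by (simp add: add_ac)
  have "(\<integral>z. w (x + a + z) \<partial>\<kappa>) - (\<integral>z. w (x + z) \<partial>\<kappa>)
      = smoothed \<kappa> ?f (x + a + b) - smoothed \<kappa> ?f (x + a) - smoothed \<kappa> ?f (x + b) + smoothed \<kappa> ?f x"
    unfolding w' by simp
  ultimately show "\<bar>smoothed \<kappa> ?f (x + a + b) - smoothed \<kappa> ?f (x + a) - smoothed \<kappa> ?f (x + b)
      + smoothed \<kappa> ?f x\<bar> \<le> C * C * B * norm a * norm b"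
    by (simp add: mult_ac)
qed

lemma smoothed_close:
  assumes f: "f \<in> borel_measurable borel" "\<And>x. \<bar>f x\<bar> \<le> B"
    and lip: "\<And>x a. \<bar>f (x + a) - f x\<bar> \<le> norm a"
    and \<delta>: "AE z in \<kappa>. norm z \<le> \<delta>"
  shows "\<bar>smoothed \<kappa> f x - f x\<bar> \<le> \<delta>"
proof -
  have i: "integrable \<kappa> (\<lambda>z. f (x + z))"
    using integrable_shift_bounded[of f B] f by auto
  have "smoothed \<kappa> f x - f x = (\<integral>z. f (x + z) - f x \<partial>\<kappa>)"
    using i by (simp add: smoothed_def prob_space)
  also have "\<bar>\<dots>\<bar> \<le> (\<integral>z. \<delta> \<partial>\<kappa>)"
  proof -
    have "norm (\<integral>z. f (x + z) - f x \<partial>\<kappa>) \<le> (\<integral>z. norm (f (x + z) - f x) \<partial>\<kappa>)"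
      by (rule integral_norm_bound)
    also have "\<dots> \<le> (\<integral>z. \<delta> \<partial>\<kappa>)"
    proof (rule integral_mono_AE)
      show "AE z in \<kappa>. norm (f (x + z) - f x) \<le> \<delta>"
        using \<delta> by eventually_elim (use lip in \<open>auto intro: order_trans\<close>)
    qed (use i in auto)
    finally show ?thesis by simp
  qed
  finally show ?thesis by (simp add: prob_space)
qed

lemma smoothed_lipschitz:
  assumes f: "f \<in> borel_measurable borel" "\<And>x. \<bar>f x\<bar> \<le> B"
    and lip: "\<And>x a. \<bar>f (x + a) - f x\<bar> \<le> norm a"
  shows "\<bar>smoothed \<kappa> f (x + a) - smoothed \<kappa> f x\<bar> \<le> norm a"
proof -
  have i: "integrable \<kappa> (\<lambda>z. f (y + z))" for y
    using integrable_shift_bounded[of f B] f by auto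
  have "smoothed \<kappa> f (x + a) - smoothed \<kappa> f x = (\<integral>z. f (x + a + z) - f (x + z) \<partial>\<kappa>)"
    using i by (simp add: smoothed_def)
  also have "\<bar>\<dots>\<bar> \<le> (\<integral>z. norm a \<partial>\<kappa>)"
  proof (rule integral_abs_bound_integral)
    show "\<bar>f (x + a + z) - f (x + z)\<bar> \<le> norm a" for z
      using lip[of "x + z" a] by (simp add: algebra_simps)
  qed (use i in auto)
  finally show ?thesis by (simp add: prob_space)
qed

end

section \<open>Trigonometric polynomials\<close>

text \<open>The complex coefficient covers sines and cosines together, and induction reduces every
  additive statement to a single frequency.\<close>

inductive trig_poly :: "('a::euclidean_space \<Rightarrow> real) \<Rightarrow> bool" where
  monomial: "trig_poly (\<lambda>x. Re (c * iexp (\<xi> \<bullet> x)))"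
| add: "trig_poly f \<Longrightarrow> trig_poly g \<Longrightarrow> trig_poly (\<lambda>x. f x + g x)"

lemma trig_poly_const: "trig_poly (\<lambda>_. r)"
  using trig_poly.monomial[of "complex_of_real r" 0] by simp

lemma trig_poly_sum: "finite I \<Longrightarrow> (\<And>i. i \<in> I \<Longrightarrow> trig_poly (f i)) \<Longrightarrow> trig_poly (\<lambda>x. \<Sum>i\<in>I. f i x)"
  by (induction I rule: finite_induct) (auto intro: trig_poly_const trig_poly.add)

text \<open>The product-to-sum formula: two frequencies combine into their sum and their difference,
  by \<open>Re z * Re w = Re (z * w / 2) + Re (z * cnj w / 2)\<close>.\<close>

lemma trig_poly_mult:
  assumes "trig_poly f" "trig_poly g"
  shows "trig_poly (\<lambda>x. f x * g x)"
  using assms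
proof (induction f)
  case (monomial c \<xi>)
  then show ?case
  proof (induction g)
    case (monomial d \<eta>)
    have "Re (c * iexp (\<xi> \<bullet> x)) * Re (d * iexp (\<eta> \<bullet> x))
       = Re (c * d / 2 * iexp ((\<xi> + \<eta>) \<bullet> x)) + Re (c * cnj d / 2 * iexp ((\<xi> - \<eta>) \<bullet> x))" for x
    proof -
      have p: "Re z * Re w = Re (z * w / 2) + Re (z * cnj w / 2)" for z w by (simp add: field_simps)
      have "c * iexp (\<xi> \<bullet> x) * (d * iexp (\<eta> \<bullet> x)) = c * d * iexp ((\<xi> + \<eta>) \<bullet> x)"
        by (simp add: inner_left_distrib exp_add distrib_left)
      moreover have "c * iexp (\<xi> \<bullet> x) * cnj (d * iexp (\<eta> \<bullet> x)) = c * cnj d * iexp ((\<xi> - \<eta>) \<bullet> x)"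
        by (simp add: inner_diff_left exp_cnj right_diff_distrib exp_diff exp_minus divide_inverse)
      ultimately show ?thesis by (simp only: p times_divide_eq_left)
    qed
    then show ?case by (simp only: trig_poly.intros)
  next
    case (add f g)
    then show ?case by (simp add: distrib_left trig_poly.add)
  qed
next
  case (add f g)
  then show ?case by (simp add: distrib_right trig_poly.add)
qed

lemma trig_poly_continuous: "trig_poly f \<Longrightarrow> continuous_on UNIV f"
  by (induction rule: trig_poly.induct) (auto intro!: continuous_intros)

lemma trig_poly_measurable: "trig_poly f \<Longrightarrow> f \<in> borel_measurable borel"
  by (simp add: borel_measurable_continuous_onI trig_poly_continuous)

lemma trig_poly_bounded: "trig_poly f \<Longrightarrow> \<exists>B. \<forall>x. \<bar>f x\<bar> \<le> B"
proof (induction rule: trig_poly.induct)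
  case (monomial c \<xi>)
  have "\<bar>Re (c * iexp (\<xi> \<bullet> x))\<bar> \<le> norm c" for x
    using abs_Re_le_cmod[of "c * iexp (\<xi> \<bullet> x)"] by (simp add: norm_mult)
  then show ?case by blast
next
  case (add f g)
  then obtain B B' where "\<forall>x. \<bar>f x\<bar> \<le> B" "\<forall>x. \<bar>g x\<bar> \<le> B'" by blast
  then have "\<forall>x. \<bar>f x + g x\<bar> \<le> B + B'" by (meson abs_triangle_ineq add_mono order_trans)
  then show ?case by blast
qed

text \<open>Averaging multiplies the coefficient at the frequency \<open>\<xi>\<close> by
  \<open>char_fun \<kappa> \<xi>\<close> and leaves the frequency as it is.\<close>

lemma trig_poly_smoothed:
  assumes "prob_space \<kappa>" "sets \<kappa> = sets borel" "trig_poly f"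
  shows "trig_poly (smoothed \<kappa> f)"
  using assms(3)
proof (induction rule: trig_poly.induct)
  case (monomial c \<xi>)
  have i: "integrable \<kappa> (\<lambda>z. iexp (\<xi> \<bullet> z))"
    using integrable_shift_bounded[OF assms(1,2), of "\<lambda>z. iexp (\<xi> \<bullet> z)" 1 0] by simp
  have "smoothed \<kappa> (\<lambda>x. Re (c * iexp (\<xi> \<bullet> x))) = (\<lambda>x. Re (c * char_fun \<kappa> \<xi> * iexp (\<xi> \<bullet> x)))"
  proof
    fix x
    have "smoothed \<kappa> (\<lambda>x. Re (c * iexp (\<xi> \<bullet> x))) x = (\<integral>z. Re (c * iexp (\<xi> \<bullet> x) * iexp (\<xi> \<bullet> z)) \<partial>\<kappa>)"
      unfolding smoothed_def by (simp add: inner_right_distrib exp_add distrib_left mult.assoc)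
    also have "\<dots> = Re (\<integral>z. c * iexp (\<xi> \<bullet> x) * iexp (\<xi> \<bullet> z) \<partial>\<kappa>)"
      by (rule integral_Re) (use i in auto)
    also have "\<dots> = Re (c * char_fun \<kappa> \<xi> * iexp (\<xi> \<bullet> x))"
      by (subst integral_mult_right_zero) (simp add: char_fun_def mult_ac)
    finally show "smoothed \<kappa> (\<lambda>x. Re (c * iexp (\<xi> \<bullet> x))) x = Re (c * char_fun \<kappa> \<xi> * iexp (\<xi> \<bullet> x))" .
  qed
  then show ?case by (simp only: trig_poly.monomial)
next
  case (add f g)
  obtain B B' where "\<And>x. \<bar>f x\<bar> \<le> B" "\<And>x. \<bar>g x\<bar> \<le> B'" using add trig_poly_bounded by meson
  then have "smoothed \<kappa> (\<lambda>x. f x + g x) = (\<lambda>x. smoothed \<kappa> f x + smoothed \<kappa> g x)"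
    using smoothed_add[OF assms(1,2)] add trig_poly_measurable by blast
  then show ?case using add trig_poly.add by simp
qed

section \<open>A bounded substitution by sines\<close>

text \<open>
  Composition with this map turns polynomials into trigonometric polynomials, and as it is
  1-Lipschitz with second differences of order \<open>1 / R\<close>, it almost preserves bounds on second differences.
\<close>

definition sine_map :: "real \<Rightarrow> 'a::euclidean_space \<Rightarrow> 'a" where
  "sine_map R x = (\<Sum>i\<in>Basis. (R * sin ((x \<bullet> i) / R)) *\<^sub>R i)"

lemma sine_map_inner: "i \<in> Basis \<Longrightarrow> sine_map R x \<bullet> i = R * sin ((x \<bullet> i) / R)"
  by (simp add: sine_map_def)

lemma abs_sin_diff_le: "\<bar>sin (x + a) - sin x\<bar> \<le> \<bar>a::real\<bar>"
proof -
  have "\<bar>sin (x + a) - sin x\<bar> = 2 * \<bar>sin (a / 2)\<bar> * \<bar>cos ((x + a + x) / 2)\<bar>"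
    by (simp add: sin_diff_sin abs_mult)
  also have "\<dots> \<le> 2 * \<bar>a / 2\<bar> * 1"
    by (intro mult_mono abs_sin_x_le_abs_x) auto
  finally show ?thesis by simp
qed

lemma abs_cos_diff_le: "\<bar>cos (x + a) - cos x\<bar> \<le> \<bar>a::real\<bar>"
  using abs_sin_diff_le[of "x + pi / 2" a] by (simp add: sin_add cos_add)

lemma abs_sin_second_diff_le: "\<bar>sin (x + a + b) - sin (x + a) - sin (x + b) + sin x\<bar> \<le> \<bar>a\<bar> * \<bar>b::real\<bar>"
proof -
  have "sin (x + a + b) - sin (x + a) - sin (x + b) + sin x
      = 2 * sin (b / 2) * (cos (x + b / 2 + a) - cos (x + b / 2))"
  proof -
    have "sin (x + a + b) - sin (x + a) = 2 * sin (b / 2) * cos (x + b / 2 + a)"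
      by (subst sin_diff_sin) (simp add: field_simps)
    moreover have "sin (x + b) - sin x = 2 * sin (b / 2) * cos (x + b / 2)"
      by (subst sin_diff_sin) (simp add: field_simps)
    ultimately show ?thesis by (simp add: right_diff_distrib)
  qed
  also have "\<bar>\<dots>\<bar> = 2 * \<bar>sin (b / 2)\<bar> * \<bar>cos (x + b / 2 + a) - cos (x + b / 2)\<bar>"
    by (simp add: abs_mult)
  also have "\<dots> \<le> 2 * \<bar>b / 2\<bar> * \<bar>a\<bar>"
    by (intro mult_mono abs_sin_x_le_abs_x abs_cos_diff_le) auto
  finally show ?thesis by (simp add: mult.commute)
qed

lemma sine_map_lipschitz:
  assumes "0 < R"
  shows "norm (sine_map R (x + a) - sine_map R x) \<le> norm a"
proof (rule norm_le_componentwise)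
  fix i :: 'a assume i: "i \<in> Basis"
  have "\<bar>(sine_map R (x + a) - sine_map R x) \<bullet> i\<bar>
      = R * \<bar>sin (x \<bullet> i / R + a \<bullet> i / R) - sin (x \<bullet> i / R)\<bar>"
    using assms i by (simp add: inner_diff_left sine_map_inner abs_mult inner_left_distrib add_divide_distrib
        flip: right_diff_distrib)
  also have "\<dots> \<le> R * \<bar>a \<bullet> i / R\<bar>"
    using assms by (intro mult_left_mono abs_sin_diff_le) auto
  finally show "\<bar>(sine_map R (x + a) - sine_map R x) \<bullet> i\<bar> \<le> \<bar>a \<bullet> i\<bar>" using assms by simp
qed

text \<open>Each coordinate is at most
  \<open>\<bar>a \<bullet> i\<bar> * \<bar>b \<bullet> i\<bar> / R\<close>. Estimating only the
  first factor by \<open>norm a\<close> leaves the coordinates of a multiple of \<open>b\<close>, so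
  that summation costs no dimensional factor.\<close>

lemma sine_map_second_diff:
  assumes "0 < R"
  shows "norm (sine_map R (x + a + b) - sine_map R (x + a) - sine_map R (x + b) + sine_map R x)
    \<le> norm a * norm b / R"
proof -
  have "norm (sine_map R (x + a + b) - sine_map R (x + a) - sine_map R (x + b) + sine_map R x)
      \<le> norm ((norm a / R) *\<^sub>R b)"
  proof (rule norm_le_componentwise)
    fix i :: 'a assume i: "i \<in> Basis"
    have "\<bar>(sine_map R (x + a + b) - sine_map R (x + a) - sine_map R (x + b) + sine_map R x) \<bullet> i\<bar>
      = \<bar>R * (sin (x \<bullet> i / R + a \<bullet> i / R + b \<bullet> i / R) - sin (x \<bullet> i / R + a \<bullet> i / R)
          - sin (x \<bullet> i / R + b \<bullet> i / R) + sin (x \<bullet> i / R))\<bar>"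
      using i by (simp add: inner_diff_left sine_map_inner inner_left_distrib add_divide_distrib
          algebra_simps)
    also have "\<dots> \<le> R * (\<bar>a \<bullet> i / R\<bar> * \<bar>b \<bullet> i / R\<bar>)"
      unfolding abs_mult[of R]
      using assms by (simp only: abs_of_pos) (intro mult_left_mono abs_sin_second_diff_le, auto)
    also have "\<dots> = \<bar>a \<bullet> i\<bar> * \<bar>b \<bullet> i\<bar> / R" using assms by simp
    also have "\<dots> \<le> norm a * \<bar>b \<bullet> i\<bar> / R"
      using assms i by (intro divide_right_mono mult_right_mono Basis_le_norm) auto
    finally show "\<bar>(sine_map R (x + a + b) - sine_map R (x + a) - sine_map R (x + b) + sine_map R x) \<bullet> i\<bar>
        \<le> \<bar>((norm a / R) *\<^sub>R b) \<bullet> i\<bar>" using assms by (simp add: abs_mult)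
  qed
  then show ?thesis using assms by (simp add: mult.commute)
qed

lemma abs_scaled_sin_close:
  fixes R c :: real
  assumes "0 < R"
  shows "\<bar>R * sin (c / R) - c\<bar> \<le> c\<^sup>2 / (2 * R)"
proof -
  have sin_close: "\<bar>sin u - u\<bar> \<le> u\<^sup>2 / 2" for u :: real
    using Maclaurin_sin_bound[of u 2] by (simp add: numeral_2_eq_2 sin_coeff_def field_simps)
  have "R * sin (c / R) - c = R * (sin (c / R) - c / R)"
    using assms by (simp add: right_diff_distrib)
  then have "\<bar>R * sin (c / R) - c\<bar> = R * \<bar>sin (c / R) - c / R\<bar>"
    using assms by (simp add: abs_mult)
  also have "\<dots> \<le> R * ((c / R)\<^sup>2 / 2)"
    using assms by (intro mult_left_mono sin_close) auto
  also have "\<dots> = c\<^sup>2 / (2 * R)"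
    using assms by (simp add: power2_eq_square)
  finally show ?thesis .
qed

lemma sine_map_close:
  assumes "0 < R"
  shows "norm (sine_map R x - x) \<le> (norm x)\<^sup>2 / (2 * R)"
proof -
  have "\<bar>(sine_map R x - x) \<bullet> i\<bar> \<le> (x \<bullet> i)\<^sup>2 / (2 * R)" if "i \<in> Basis" for i
    using abs_scaled_sin_close[OF assms] that by (simp add: inner_diff_left sine_map_inner)
  then have "(\<Sum>i\<in>Basis. \<bar>(sine_map R x - x) \<bullet> i\<bar>) \<le> (\<Sum>i\<in>Basis. (x \<bullet> i)\<^sup>2 / (2 * R))"
    by (rule sum_mono)
  also have "\<dots> = (norm x)\<^sup>2 / (2 * R)"
    unfolding power2_norm_eq_inner[of x] euclidean_inner[of x x]
    by (simp add: sum_divide_distrib power2_eq_square)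
  finally show ?thesis using norm_le_l1 order_trans by blast
qed

text \<open>The range lies in a fixed compact ball, so that approximating \<open>h\<close> by a
  polynomial on this ball approximates the composition uniformly on the whole space.\<close>

lemma sine_map_norm_le:
  assumes "0 < R"
  shows "norm (sine_map R (x :: 'a::euclidean_space)) \<le> real DIM('a) * R"
proof -
  have "(\<Sum>i\<in>Basis. \<bar>sine_map R x \<bullet> i\<bar>) \<le> (\<Sum>i\<in>(Basis :: 'a set). R)"
    using assms by (intro sum_mono) (simp add: sine_map_inner abs_mult)
  then show ?thesis using norm_le_l1[of "sine_map R x"] by simp
qed

text \<open>The image of a parallelogram fails to be one by the defect \<open>\<eta>\<close>. The
  second difference of \<open>h\<close> over the true parallelogram gives the 1, and the Lipschitz
  bound on \<open>h\<close> charges the defect, which gives the \<open>1 / R\<close>.\<close>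

lemma second_diff_bound_sine_map:
  assumes R: "0 < R" and h: "second_diff_bound 1 h" and lip: "\<And>x a. \<bar>h (x + a) - h x\<bar> \<le> norm a"
  shows "second_diff_bound (1 + 1 / R) (\<lambda>x. h (sine_map R x))"
  unfolding second_diff_bound_def
proof (intro allI)
  fix x a b :: 'a
  define p where "p = sine_map R x"
  define \<alpha> where "\<alpha> = sine_map R (x + a) - p"
  define \<beta> where "\<beta> = sine_map R (x + b) - p"
  define \<eta> where "\<eta> = sine_map R (x + a + b) - sine_map R (x + a) - sine_map R (x + b) + sine_map R x"
  have "\<bar>h (p + \<alpha> + \<beta>) - h (p + \<alpha>) - h (p + \<beta>) + h p\<bar> \<le> norm \<alpha> * norm \<beta>"
    using second_diff_boundD[OF h, of p \<alpha> \<beta>] by simp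
  also have "\<dots> \<le> norm a * norm b"
    unfolding \<alpha>_def \<beta>_def p_def by (intro mult_mono sine_map_lipschitz R) auto
  finally have 1: "\<bar>h (p + \<alpha> + \<beta>) - h (p + \<alpha>) - h (p + \<beta>) + h p\<bar> \<le> norm a * norm b" .
  have 2: "\<bar>h (p + \<alpha> + \<beta> + \<eta>) - h (p + \<alpha> + \<beta>)\<bar> \<le> norm a * norm b / R"
    using lip[of "p + \<alpha> + \<beta>" \<eta>] sine_map_second_diff[OF R, of x a b] unfolding \<eta>_def by linarith
  have "sine_map R (x + a + b) = p + \<alpha> + \<beta> + \<eta>" "sine_map R (x + a) = p + \<alpha>"
    "sine_map R (x + b) = p + \<beta>" "sine_map R x = p"
    unfolding \<alpha>_def \<beta>_def \<eta>_def p_def by auto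
  then show "\<bar>h (sine_map R (x + a + b)) - h (sine_map R (x + a)) - h (sine_map R (x + b))
      + h (sine_map R x)\<bar> \<le> (1 + 1 / R) * norm a * norm b"
    using 1 2 by (simp add: algebra_simps)
qed

lemma trig_poly_polynomial_sine_map:
  assumes "real_polynomial_function p"
  shows "trig_poly (\<lambda>x. p (sine_map R x))"
  using assms
proof (induction p rule: real_polynomial_function.induct)
  case (linear f)
  have e: "(i /\<^sub>R R) \<bullet> x = (x \<bullet> i) / R" for i x :: 'a
    by (simp add: inner_commute divide_inverse)
  \<comment> \<open>The coefficient \<open>- \<i>\<close> is chosen so that the real part of the
    exponential becomes a sine.\<close>
  have "f (sine_map R x) = (\<Sum>i\<in>Basis. Re (- \<i> * complex_of_real (R * f i) * iexp ((i /\<^sub>R R) \<bullet> x)))" for x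
    unfolding sine_map_def linear_sum[OF bounded_linear.linear[OF linear]]
      linear_scale[OF bounded_linear.linear[OF linear]]
    by (intro sum.cong refl) (simp add: Re_exp Im_exp e mult_ac del: inner_scaleR_left)
  then show ?case by (simp only:) (intro trig_poly_sum trig_poly.monomial finite_Basis)
qed (auto intro: trig_poly_const trig_poly.add trig_poly_mult)

section \<open>Approximation with control of second differences\<close>

lemma second_diff_bound_add:
  fixes f :: "'a::euclidean_space \<Rightarrow> real"
  assumes "second_diff_bound L f" "second_diff_bound L' g"
  shows "second_diff_bound (L + L') (\<lambda>x. f x + g x)"
  unfolding second_diff_bound_def
proof (intro allI)
  fix x a b :: 'a
  show "\<bar>f (x + a + b) + g (x + a + b) - (f (x + a) + g (x + a)) - (f (x + b) + g (x + b)) + (f x + g x)\<bar>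
      \<le> (L + L') * norm a * norm b"
    using second_diff_boundD[OF assms(1), of x a b] second_diff_boundD[OF assms(2), of x a b]
    by (simp add: algebra_simps)
qed

lemma second_diff_bound_mono:
  fixes f :: "'a::euclidean_space \<Rightarrow> real"
  assumes "second_diff_bound L f" "L \<le> L'"
  shows "second_diff_bound L' f"
  unfolding second_diff_bound_def
proof (intro allI)
  fix x a b :: 'a
  have "L * norm a * norm b \<le> L' * norm a * norm b" using assms(2) by (intro mult_right_mono) auto
  then show "\<bar>f (x + a + b) - f (x + a) - f (x + b) + f x\<bar> \<le> L' * norm a * norm b"
    using second_diff_boundD[OF assms(1), of x a b] by linarith
qed

text \<open>
  Stone--Weierstrass only gives closeness in the supremum norm. Averaging twice against a fixed Lipschitz
  density turns this into closeness of second differences, at the price of a constant which does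
  not depend on the approximation.
\<close>

lemma trig_poly_approximation:
  fixes h :: "'a::euclidean_space \<Rightarrow> real"
  assumes R: "0 < R" and bound: "\<And>x. \<bar>h x\<bar> \<le> 1" and lip: "\<And>x a. \<bar>h (x + a) - h x\<bar> \<le> norm a"
    and h: "second_diff_bound 1 h"
  obtains q where "trig_poly q" "second_diff_bound (1 + 2 / R) q"
    "\<And>x. \<bar>q x - h (sine_map R x)\<bar> \<le> 3 / R"
proof -
  define r where "r x = h (sine_map R x)" for x
  have r_bound: "\<bar>r x\<bar> \<le> 1" for x using bound by (simp add: r_def)
  have r_lip: "\<bar>r (x + a) - r x\<bar> \<le> norm a" for x a
    using lip[of "sine_map R x" "sine_map R (x + a) - sine_map R x"] sine_map_lipschitz[OF R, of x a]
    unfolding r_def by simp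
  have r_second: "second_diff_bound (1 + 1 / R) r"
    unfolding r_def by (rule second_diff_bound_sine_map[OF R h lip])
  have cont: "continuous_on UNIV f" if "\<And>x a. \<bar>f (x + a) - f x\<bar> \<le> norm a" for f :: "'a \<Rightarrow> real"
  proof -
    have "1-lipschitz_on UNIV f"
    proof (intro lipschitz_onI)
      fix x y :: 'a
      show "dist (f x) (f y) \<le> 1 * dist x y" using that[of y "x - y"] by (simp add: dist_norm)
    qed auto
    then show ?thesis by (rule lipschitz_on_continuous_on)
  qed
  have r_meas[measurable]: "r \<in> borel_measurable borel"
    by (intro borel_measurable_continuous_onI cont r_lip)
  obtain \<kappa> :: "'a measure" and C where \<kappa>: "prob_space \<kappa>" "sets \<kappa> = sets borel"
    "AE z in \<kappa>. norm z \<le> 1 / R" "0 \<le> C"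
    and C: "\<And>f B x a. f \<in> borel_measurable borel \<Longrightarrow> (\<And>x. \<bar>f x\<bar> \<le> B) \<Longrightarrow>
       \<bar>(\<integral>z. f (x + a + z) \<partial>\<kappa>) - (\<integral>z. f (x + z) \<partial>\<kappa>)\<bar> \<le> C * B * norm a"
    using exists_smoothing_measure[of "1 / R"] R by auto
  \<comment> \<open>Chosen after \<open>C\<close>, which depends only on \<open>R\<close>, and
    before the polynomial. It makes both \<open>\<epsilon>\<close> and
    \<open>C * C * \<epsilon>\<close> at most \<open>1 / R\<close>.\<close>
  define \<epsilon> where "\<epsilon> = 1 / (R * (C * C + 1))"
  have CC: "0 \<le> C * C" by simp
  then have CC1: "0 < C * C + 1" by linarith
  have \<epsilon>: "0 < \<epsilon>" unfolding \<epsilon>_def by (intro divide_pos_pos mult_pos_pos R CC1) simp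
  have \<epsilon>R: "\<epsilon> \<le> 1 / R" unfolding \<epsilon>_def
    by (intro divide_left_mono mult_pos_pos R CC1) (use R CC in auto)
  have "C * C * \<epsilon> = (1 / R) * (C * C / (C * C + 1))" by (simp add: \<epsilon>_def)
  also have "\<dots> \<le> (1 / R) * 1" using R CC CC1 by (intro mult_left_mono) (simp_all only: divide_le_eq_1_pos, simp_all)
  finally have \<epsilon>C: "C * C * \<epsilon> \<le> 1 / R" by simp
  obtain p where p: "real_polynomial_function p"
    and p_close: "\<And>x. x \<in> cball 0 (real DIM('a) * R) \<Longrightarrow> \<bar>h x - p x\<bar> < \<epsilon>"
    using Stone_Weierstrass_real_polynomial_function[of "cball 0 (real DIM('a) * R)" h \<epsilon>]
      continuous_on_subset[OF cont[OF lip]] \<epsilon> by auto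
  define q0 where "q0 x = p (sine_map R x)" for x
  have q0: "trig_poly q0" unfolding q0_def by (rule trig_poly_polynomial_sine_map[OF p])
  have q0_meas[measurable]: "q0 \<in> borel_measurable borel" by (rule trig_poly_measurable[OF q0])
  define e where "e x = q0 x - r x" for x
  have e_bound: "\<bar>e x\<bar> \<le> \<epsilon>" for x
    using p_close[of "sine_map R x"] sine_map_norm_le[OF R, of x] unfolding e_def q0_def r_def by auto
  have e_meas[measurable]: "e \<in> borel_measurable borel" unfolding e_def by measurable
  let ?A = "smoothed \<kappa>"
  note sm = smoothed_measurable[OF \<kappa>(1,2)] smoothed_bound[OF \<kappa>(1,2)]
  \<comment> \<open>The two summands are treated differently: \<open>r\<close> already has good
    second differences, which averaging preserves, whereas \<open>e\<close> is merely small and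
    acquires a bound from the two averagings. The supremum error is \<open>1 / R\<close> for each
    averaging of \<open>r\<close> plus \<open>\<epsilon>\<close> for \<open>e\<close>, hence
    \<open>3 / R\<close>.\<close>
  have q0_eq: "q0 = (\<lambda>x. r x + e x)" by (simp add: e_def fun_eq_iff)
  have "?A q0 = (\<lambda>x. ?A r x + ?A e x)"
    unfolding q0_eq by (rule smoothed_add[OF \<kappa>(1,2) r_meas r_bound e_meas e_bound])
  then have Aq: "?A (?A q0) = (\<lambda>x. ?A (?A r) x + ?A (?A e) x)"
    using smoothed_add[OF \<kappa>(1,2) sm(1)[OF r_meas] sm(2)[OF r_meas r_bound] sm(1)[OF e_meas]
        sm(2)[OF e_meas e_bound]] by simp
  show ?thesis
  proof (rule that[of "?A (?A q0)"])
    show "trig_poly (?A (?A q0))" by (intro trig_poly_smoothed \<kappa> q0)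
    have "second_diff_bound (1 + 1 / R) (?A (?A r))"
      using second_diff_bound_smoothed[OF \<kappa>(1,2)] sm r_meas r_bound r_second by metis
    moreover have "second_diff_bound (C * C * \<epsilon>) (?A (?A e))"
      by (rule second_diff_bound_smoothed_twice[OF \<kappa>(1,2) e_meas e_bound C])
    ultimately have "second_diff_bound (1 + 1 / R + C * C * \<epsilon>) (?A (?A q0))"
      unfolding Aq by (rule second_diff_bound_add)
    then show "second_diff_bound (1 + 2 / R) (?A (?A q0))"
      by (rule second_diff_bound_mono) (use \<epsilon>C in simp)
    show "\<bar>?A (?A q0) x - h (sine_map R x)\<bar> \<le> 3 / R" for x
    proof -
      have "\<bar>?A r x - r x\<bar> \<le> 1 / R"
        by (rule smoothed_close[OF \<kappa>(1,2) r_meas r_bound r_lip \<kappa>(3)])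
      moreover have "\<bar>?A (?A r) x - ?A r x\<bar> \<le> 1 / R"
        by (rule smoothed_close[OF \<kappa>(1,2) sm(1)[OF r_meas] sm(2)[OF r_meas r_bound]
              smoothed_lipschitz[OF \<kappa>(1,2) r_meas r_bound r_lip] \<kappa>(3)])
      moreover have "\<bar>?A (?A e) x\<bar> \<le> \<epsilon>"
        by (intro sm e_meas e_bound)
      ultimately show ?thesis unfolding Aq r_def[symmetric] using \<epsilon>R by linarith
    qed
  qed
qed

text \<open>Taking \<open>R = Suc n\<close>, the error at \<open>x\<close> is \<open>3 / R\<close>
  plus \<open>(norm x)\<^sup>2 / (2 * R)\<close>, the latter from \<open>sine_map_close\<close>, so
  convergence is only pointwise. The uniform bound \<open>4 = 1 + 3\<close> is there for dominated
  convergence.\<close>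

lemma trig_poly_approximating_sequence:
  fixes h :: "'a::euclidean_space \<Rightarrow> real"
  assumes bound: "\<And>x. \<bar>h x\<bar> \<le> 1" and lip: "\<And>x a. \<bar>h (x + a) - h x\<bar> \<le> norm a"
    and h: "second_diff_bound 1 h"
  obtains q where "\<And>n. trig_poly (q n)" "\<And>n. second_diff_bound (1 + 2 / real (Suc n)) (q n)"
    "\<And>n x. \<bar>q n x\<bar> \<le> 4" "\<And>x. (\<lambda>n. q n x) \<longlonglongrightarrow> h x"
proof -
  have "\<exists>q. trig_poly q \<and> second_diff_bound (1 + 2 / real (Suc n)) q \<and>
      (\<forall>x. \<bar>q x - h (sine_map (real (Suc n)) x)\<bar> \<le> 3 / real (Suc n))" for n
    using trig_poly_approximation[OF _ bound lip h, of "real (Suc n)"] by (metis of_nat_0_less_iff zero_less_Suc)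
  then obtain q where q: "\<And>n. trig_poly (q n)" "\<And>n. second_diff_bound (1 + 2 / real (Suc n)) (q n)"
    "\<And>n x. \<bar>q n x - h (sine_map (real (Suc n)) x)\<bar> \<le> 3 / real (Suc n)" by metis
  show ?thesis
  proof (rule that[OF q(1,2)])
    show "\<bar>q n x\<bar> \<le> 4" for n x
    proof -
      have "3 / real (Suc n) \<le> 3" by (simp add: field_simps)
      then show ?thesis using q(3)[of n x] bound[of "sine_map (real (Suc n)) x"] by linarith
    qed
    show "(\<lambda>n. q n x) \<longlonglongrightarrow> h x" for x
    proof (rule LIM_zero_cancel, rule Lim_null_comparison)
      have "\<bar>q n x - h x\<bar> \<le> (3 + (norm x)\<^sup>2) * (1 / real (Suc n))" for n
      proof -
        have "\<bar>h (sine_map (real (Suc n)) x) - h x\<bar> \<le> (norm x)\<^sup>2 / (2 * real (Suc n))"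
          using lip[of x "sine_map (real (Suc n)) x - x"] sine_map_close[of "real (Suc n)" x] by simp
        also have "\<dots> \<le> (norm x)\<^sup>2 / real (Suc n)"
          by (intro divide_left_mono) auto
        finally show ?thesis using q(3)[of n x]
          by (simp add: distrib_right add_divide_distrib)
      qed
      then show "\<forall>\<^sub>F n in sequentially. norm (q n x - h x) \<le> (3 + (norm x)\<^sup>2) * (1 / real (Suc n))"
        by simp
      show "(\<lambda>n. (3 + (norm x)\<^sup>2) * (1 / real (Suc n))) \<longlonglongrightarrow> 0"
        using tendsto_mult_right_zero[OF LIMSEQ_inverse_real_of_nat] by (simp add: divide_inverse)
    qed
  qed
qed

section \<open>Characteristic functions of centered infinitely divisible laws\<close>

lemma cmod_iexp_linear_le: "cmod (iexp t - 1 - \<i> * complex_of_real t) \<le> t\<^sup>2 / 2"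
  using iexp_approx1[of t 1] by (simp add: power2_eq_square fact_numeral algebra_simps numeral_2_eq_2)

lemma cmod_iexp_diff_one_le: "cmod (iexp t - 1) \<le> \<bar>t\<bar>"
  using iexp_approx1[of t 0] by simp

lemma cos_ge_one_minus: "1 - t\<^sup>2 / 2 \<le> cos (t::real)"
  using abs_Re_le_cmod[of "iexp t - 1 - \<i> * complex_of_real t"] cmod_iexp_linear_le[of t]
  by (simp add: Re_exp)

lemma inner_square_le: "(\<xi> \<bullet> u)\<^sup>2 \<le> (norm \<xi>)\<^sup>2 * (norm u)\<^sup>2"
  using Cauchy_Schwarz_ineq[of \<xi> u] by (simp add: power2_norm_eq_inner)

lemma integrable_inner_square:
  fixes M :: "'a::euclidean_space measure"
  assumes [measurable_cong]: "sets M = sets borel" and "integrable M (\<lambda>u. (norm u)\<^sup>2)"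
  shows "integrable M (\<lambda>u. (\<xi> \<bullet> u)\<^sup>2)"
  by (rule Bochner_Integration.integrable_bound[OF integrable_mult_right[OF assms(2), of "(norm \<xi>)\<^sup>2"]])
     (auto simp: inner_square_le)

text \<open>The Levy--Khintchine exponent with the linear term subtracted everywhere instead of on
  the unit ball only. It converges when \<open>\<nu>\<close> has a second moment, and in this form a
  centered law has no drift.\<close>

definition levy_exponent :: "'a::euclidean_space measure \<Rightarrow> 'a \<Rightarrow> complex" where
  "levy_exponent \<nu> \<xi> = (\<integral>u. (iexp (\<xi> \<bullet> u) - 1 - \<i> * complex_of_real (\<xi> \<bullet> u)) \<partial>\<nu>)"

lemma integrable_levy_exponent:
  fixes \<nu> :: "'a::euclidean_space measure"
  assumes [measurable_cong]: "sets \<nu> = sets borel" and "integrable \<nu> (\<lambda>u. (norm u)\<^sup>2)"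
  shows "integrable \<nu> (\<lambda>u. iexp (\<xi> \<bullet> u) - 1 - \<i> * complex_of_real (\<xi> \<bullet> u))"
proof (rule Bochner_Integration.integrable_bound[OF integrable_inner_square[OF assms, of \<xi>]])
  show "AE u in \<nu>. cmod (iexp (\<xi> \<bullet> u) - 1 - \<i> * complex_of_real (\<xi> \<bullet> u)) \<le> norm ((\<xi> \<bullet> u)\<^sup>2)"
  proof (rule AE_I2)
    fix u
    show "cmod (iexp (\<xi> \<bullet> u) - 1 - \<i> * complex_of_real (\<xi> \<bullet> u)) \<le> norm ((\<xi> \<bullet> u)\<^sup>2)"
      using order_trans[OF cmod_iexp_linear_le[of "\<xi> \<bullet> u"], of "(\<xi> \<bullet> u)\<^sup>2"] by simp
  qed
qed auto

text \<open>With a remainder quadratic in \<open>s - t\<close>, the error of the difference quotient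
  is at most \<open>\<bar>h\<bar>\<close> times the integral of \<open>B\<close>, which tends to 0.
  It serves both \<open>char_fun\<close> and \<open>levy_exponent\<close>, each time with
  \<open>B\<close> equal to half of \<open>(\<xi> \<bullet> u)\<^sup>2\<close>.\<close>

lemma has_vector_derivative_integral_quadratic:
  fixes F :: "real \<Rightarrow> 'a \<Rightarrow> complex"
  assumes F: "\<And>s. integrable M (F s)" and F': "integrable M F'" and B: "integrable M B"
    and rem: "\<And>s u. cmod (F s u - F t u - (s - t) *\<^sub>R F' u) \<le> (s - t)\<^sup>2 * B u"
  shows "((\<lambda>s. \<integral>u. F s u \<partial>M) has_vector_derivative (\<integral>u. F' u \<partial>M)) (at t)"
  unfolding has_vector_derivative_def has_derivative_at
proof
  show "bounded_linear (\<lambda>x. x *\<^sub>R (\<integral>u. F' u \<partial>M))" by (rule bounded_linear_scaleR_left)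
  show "(\<lambda>h. norm ((\<integral>u. F (t + h) u \<partial>M) - (\<integral>u. F t u \<partial>M) - h *\<^sub>R (\<integral>u. F' u \<partial>M)) / norm h) \<midarrow>0\<rightarrow> 0"
  proof (rule Lim_null_comparison)
    show "\<forall>\<^sub>F h in at 0. norm (norm ((\<integral>u. F (t + h) u \<partial>M) - (\<integral>u. F t u \<partial>M) - h *\<^sub>R (\<integral>u. F' u \<partial>M)) / norm h)
        \<le> \<bar>h\<bar> * (\<integral>u. B u \<partial>M)"
    proof (rule always_eventually, rule allI)
      fix h
      have "(\<integral>u. F (t + h) u \<partial>M) - (\<integral>u. F t u \<partial>M) - h *\<^sub>R (\<integral>u. F' u \<partial>M)
          = (\<integral>u. F (t + h) u - F t u - h *\<^sub>R F' u \<partial>M)"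
        using F F' by simp
      also have "norm \<dots> \<le> (\<integral>u. norm (F (t + h) u - F t u - h *\<^sub>R F' u) \<partial>M)"
        by (rule integral_norm_bound)
      also have "\<dots> \<le> (\<integral>u. h\<^sup>2 * B u \<partial>M)"
        using F F' B rem[of "t + h"] by (intro integral_mono) auto
      also have "\<dots> = h\<^sup>2 * (\<integral>u. B u \<partial>M)" by simp
      finally have *: "norm ((\<integral>u. F (t + h) u \<partial>M) - (\<integral>u. F t u \<partial>M) - h *\<^sub>R (\<integral>u. F' u \<partial>M))
          \<le> \<bar>h\<bar> * (\<bar>h\<bar> * (\<integral>u. B u \<partial>M))" by (simp add: power2_eq_square)
      show "norm (norm ((\<integral>u. F (t + h) u \<partial>M) - (\<integral>u. F t u \<partial>M) - h *\<^sub>R (\<integral>u. F' u \<partial>M)) / norm h)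
        \<le> \<bar>h\<bar> * (\<integral>u. B u \<partial>M)"
      proof (cases "h = 0")
        case False
        then show ?thesis using * by (simp add: divide_le_eq mult.commute)
      qed simp
    qed
    show "(\<lambda>h. \<bar>h\<bar> * (\<integral>u. B u \<partial>M)) \<midarrow>0\<rightarrow> 0"
      by (rule tendsto_mult_left_zero) (rule tendsto_rabs_zero, rule tendsto_ident_at)
  qed
qed

lemma cmod_iexp_remainder_le:
  "cmod (iexp (s * q) - iexp (t * q) - (s - t) *\<^sub>R (\<i> * complex_of_real q * iexp (t * q))) \<le> (s - t)\<^sup>2 * (q\<^sup>2 / 2)"
proof -
  have "iexp (s * q) = iexp (t * q) * iexp ((s - t) * q)"
    by (simp add: exp_add[symmetric] algebra_simps)
  then have "iexp (s * q) - iexp (t * q) - (s - t) *\<^sub>R (\<i> * complex_of_real q * iexp (t * q))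
      = iexp (t * q) * (iexp ((s - t) * q) - 1 - \<i> * complex_of_real ((s - t) * q))"
    by (simp add: scaleR_conv_of_real algebra_simps)
  also have "cmod \<dots> \<le> ((s - t) * q)\<^sup>2 / 2"
    unfolding norm_mult using cmod_iexp_linear_le[of "(s - t) * q"] by simp
  finally show ?thesis by (simp add: power_mult_distrib)
qed

lemma integrable_inner:
  fixes M :: "'a::euclidean_space measure"
  assumes "prob_space M" and [measurable_cong]: "sets M = sets borel"
    and sq: "integrable M (\<lambda>u. (norm u)\<^sup>2)"
  shows "integrable M (\<lambda>u. u)" "integrable M (\<lambda>u. \<xi> \<bullet> u)"
proof -
  interpret prob_space M by fact
  have le: "a \<le> 1 + a\<^sup>2" for a :: real
    using zero_le_power2[of "a - 1"] zero_le_power2[of "a + 1"] by (simp add: power2_eq_square algebra_simps)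
  show "integrable M (\<lambda>u. u)"
    by (rule Bochner_Integration.integrable_bound[OF Bochner_Integration.integrable_add[OF integrable_const[of 1] sq]])
       (auto simp: le)
  then show "integrable M (\<lambda>u. \<xi> \<bullet> u)" by (rule integrable_inner_right)
qed

lemma has_vector_derivative_char_fun:
  fixes M :: "'a::euclidean_space measure"
  assumes M: "prob_space M" and [measurable_cong]: "sets M = sets borel"
    and sq: "integrable M (\<lambda>u. (norm u)\<^sup>2)"
  shows "((\<lambda>s. char_fun M (s *\<^sub>R \<xi>)) has_vector_derivative
      (\<integral>u. \<i> * complex_of_real (\<xi> \<bullet> u) * iexp (t * (\<xi> \<bullet> u)) \<partial>M)) (at t)"
  unfolding char_fun_def
proof (rule has_vector_derivative_integral_quadratic[where B = "\<lambda>u. (\<xi> \<bullet> u)\<^sup>2 / 2"])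
  interpret prob_space M by fact
  show "integrable M (\<lambda>u. iexp (s *\<^sub>R \<xi> \<bullet> u))" for s
    by (rule integrable_const_bound[of _ 1]) auto
  show "integrable M (\<lambda>u. \<i> * complex_of_real (\<xi> \<bullet> u) * iexp (t * (\<xi> \<bullet> u)))"
    by (rule Bochner_Integration.integrable_bound[OF integrable_inner(2)[OF M assms(2) sq, of \<xi>]])
       (auto simp: norm_mult)
  show "integrable M (\<lambda>u. (\<xi> \<bullet> u)\<^sup>2 / 2)"
    using integrable_inner_square[OF assms(2) sq, of \<xi>] by simp
  show "cmod (iexp (s *\<^sub>R \<xi> \<bullet> u) - iexp (t *\<^sub>R \<xi> \<bullet> u)
      - (s - t) *\<^sub>R (\<i> * complex_of_real (\<xi> \<bullet> u) * iexp (t * (\<xi> \<bullet> u)))) \<le> (s - t)\<^sup>2 * ((\<xi> \<bullet> u)\<^sup>2 / 2)" for s u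
    using cmod_iexp_remainder_le[of s "\<xi> \<bullet> u" t] by simp
qed

lemma integrable_levy_exponent_derivative:
  fixes \<nu> :: "'a::euclidean_space measure"
  assumes [measurable_cong]: "sets \<nu> = sets borel" and sq: "integrable \<nu> (\<lambda>u. (norm u)\<^sup>2)"
  shows "integrable \<nu> (\<lambda>u. \<i> * complex_of_real (\<xi> \<bullet> u) * (iexp (t * (\<xi> \<bullet> u)) - 1))"
proof (rule Bochner_Integration.integrable_bound[OF integrable_mult_right[OF integrable_inner_square[OF assms, of \<xi>], of "\<bar>t\<bar>"]])
  show "AE u in \<nu>. norm (\<i> * complex_of_real (\<xi> \<bullet> u) * (iexp (t * (\<xi> \<bullet> u)) - 1)) \<le> norm (\<bar>t\<bar> * (\<xi> \<bullet> u)\<^sup>2)"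
  proof (rule AE_I2)
    fix u
    have "norm (\<i> * complex_of_real (\<xi> \<bullet> u) * (iexp (t * (\<xi> \<bullet> u)) - 1)) = \<bar>\<xi> \<bullet> u\<bar> * cmod (iexp (t * (\<xi> \<bullet> u)) - 1)"
      by (simp add: norm_mult)
    also have "\<dots> \<le> \<bar>\<xi> \<bullet> u\<bar> * \<bar>t * (\<xi> \<bullet> u)\<bar>"
      by (intro mult_left_mono cmod_iexp_diff_one_le) auto
    also have "\<dots> = norm (\<bar>t\<bar> * (\<xi> \<bullet> u)\<^sup>2)" by (simp add: abs_mult power2_eq_square)
    finally show "norm (\<i> * complex_of_real (\<xi> \<bullet> u) * (iexp (t * (\<xi> \<bullet> u)) - 1)) \<le> norm (\<bar>t\<bar> * (\<xi> \<bullet> u)\<^sup>2)" .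
  qed
qed auto

lemma has_vector_derivative_levy_exponent:
  fixes \<nu> :: "'a::euclidean_space measure"
  assumes \<nu>: "sets \<nu> = sets borel" and sq: "integrable \<nu> (\<lambda>u. (norm u)\<^sup>2)"
  shows "((\<lambda>s. levy_exponent \<nu> (s *\<^sub>R \<xi>)) has_vector_derivative
      (\<integral>u. \<i> * complex_of_real (\<xi> \<bullet> u) * (iexp (t * (\<xi> \<bullet> u)) - 1) \<partial>\<nu>)) (at t)"
  unfolding levy_exponent_def
proof (rule has_vector_derivative_integral_quadratic[where B = "\<lambda>u. (\<xi> \<bullet> u)\<^sup>2 / 2"])
  show "integrable \<nu> (\<lambda>u. iexp (s *\<^sub>R \<xi> \<bullet> u) - 1 - \<i> * complex_of_real (s *\<^sub>R \<xi> \<bullet> u))" for s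
    by (rule integrable_levy_exponent[OF assms])
  show "integrable \<nu> (\<lambda>u. (\<xi> \<bullet> u)\<^sup>2 / 2)"
    using integrable_inner_square[OF assms, of \<xi>] by simp
  show "cmod (iexp (s *\<^sub>R \<xi> \<bullet> u) - 1 - \<i> * complex_of_real (s *\<^sub>R \<xi> \<bullet> u)
      - (iexp (t *\<^sub>R \<xi> \<bullet> u) - 1 - \<i> * complex_of_real (t *\<^sub>R \<xi> \<bullet> u))
      - (s - t) *\<^sub>R (\<i> * complex_of_real (\<xi> \<bullet> u) * (iexp (t * (\<xi> \<bullet> u)) - 1)))
      \<le> (s - t)\<^sup>2 * ((\<xi> \<bullet> u)\<^sup>2 / 2)" for s u
    using cmod_iexp_remainder_le[of s "\<xi> \<bullet> u" t]
    by (simp add: scaleR_conv_of_real algebra_simps)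
qed (rule integrable_levy_exponent_derivative[OF assms])

section \<open>Levy measures and their second moments\<close>

lemma levy_measure_sets: "levy_measure \<nu> \<Longrightarrow> sets \<nu> = sets borel"
  by (simp add: levy_measure_def)

lemma integrable_levy_measure:
  assumes "levy_measure \<nu>"
  shows "integrable \<nu> (\<lambda>u. min 1 ((norm u)\<^sup>2))"
proof (rule integrableI_nonneg)
  note [measurable_cong] = levy_measure_sets[OF assms]
  show "(\<lambda>u. min 1 ((norm u)\<^sup>2)) \<in> borel_measurable \<nu>" by measurable
qed (use assms in \<open>auto simp: levy_measure_def\<close>)

text \<open>By Markov's inequality the complement of every ball around 0 has finite mass, and the
  origin itself is a null set. This is what gives access to Fubini on the product with the law of
  \<open>Y\<close>.\<close>

lemma sigma_finite_levy_measure: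
  fixes \<nu> :: "'a::euclidean_space measure"
  assumes "levy_measure \<nu>"
  shows "sigma_finite_measure \<nu>"
proof
  note sets = levy_measure_sets[OF assms]
  note [measurable_cong] = sets
  define B :: "nat \<Rightarrow> 'a set" where "B n = {u. 1 / real (Suc n) \<le> norm u}" for n
  have B[measurable]: "B n \<in> sets borel" for n unfolding B_def by measurable
  have fin: "emeasure \<nu> (B n) \<noteq> \<infinity>" for n
  proof -
    have "ennreal ((1 / real (Suc n))\<^sup>2) * emeasure \<nu> (B n)
        = (\<integral>\<^sup>+u. ennreal ((1 / real (Suc n))\<^sup>2) * indicator (B n) u \<partial>\<nu>)"
      by (simp add: nn_integral_cmult_indicator sets)
    also have "\<dots> \<le> (\<integral>\<^sup>+u. ennreal (min 1 ((norm u)\<^sup>2)) \<partial>\<nu>)"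
    proof (rule nn_integral_mono)
      fix u :: 'a
      have "(1 / real (Suc n))\<^sup>2 \<le> min 1 ((norm u)\<^sup>2)" if "1 / real (Suc n) \<le> norm u"
        using power_mono[OF that, of 2] power_mono[of "1 / real (Suc n)" 1 2] by simp
      then show "ennreal ((1 / real (Suc n))\<^sup>2) * indicator (B n) u \<le> ennreal (min 1 ((norm u)\<^sup>2))"
        by (auto simp: indicator_def B_def intro!: ennreal_leI)
    qed
    also have "\<dots> < \<infinity>" using assms by (simp add: levy_measure_def)
    finally show ?thesis by (auto simp: ennreal_mult_less_top)
  qed
  show "\<exists>A. countable A \<and> A \<subseteq> sets \<nu> \<and> \<Union> A = space \<nu> \<and> (\<forall>a\<in>A. emeasure \<nu> a \<noteq> \<infinity>)"
  proof (intro exI[of _ "insert {0} (range B)"] conjI ballI)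
    have "u \<in> \<Union> (insert {0} (range B))" for u
    proof (cases "u = 0")
      case False
      then obtain n where "inverse (real (Suc n)) < norm u" using reals_Archimedean[of "norm u"] by auto
      then have "u \<in> B n" by (simp add: B_def divide_inverse less_imp_le)
      then show ?thesis by blast
    qed simp
    then show "\<Union> (insert {0} (range B)) = space \<nu>" using sets_eq_imp_space_eq[OF sets] by auto
    show "emeasure \<nu> a \<noteq> \<infinity>" if "a \<in> insert {0} (range B)" for a
      using that fin assms by (auto simp: levy_measure_def)
  qed (auto simp: sets)
qed

lemma integrable_levy_khintchine:
  fixes \<nu> :: "'a::euclidean_space measure"
  assumes "levy_measure \<nu>"
  shows "integrable \<nu> (\<lambda>u. iexp (\<xi> \<bullet> u) - 1 - \<i> * complex_of_real ((\<xi> \<bullet> u) * indicator (cball 0 1) u))"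
proof (rule Bochner_Integration.integrable_bound[OF integrable_mult_right[OF integrable_levy_measure[OF assms], of "2 + (norm \<xi>)\<^sup>2"]])
  note [measurable_cong] = levy_measure_sets[OF assms]
  have [measurable]: "cball (0::'a) 1 \<in> sets borel" by simp
  show "(\<lambda>u. iexp (\<xi> \<bullet> u) - 1 - \<i> * complex_of_real ((\<xi> \<bullet> u) * indicator (cball 0 1) u)) \<in> borel_measurable \<nu>"
    by measurable
  show "AE u in \<nu>. norm (iexp (\<xi> \<bullet> u) - 1 - \<i> * complex_of_real ((\<xi> \<bullet> u) * indicator (cball 0 1) u))
      \<le> norm ((2 + (norm \<xi>)\<^sup>2) * min 1 ((norm u)\<^sup>2))"
  proof (rule AE_I2)
    fix u
    show "norm (iexp (\<xi> \<bullet> u) - 1 - \<i> * complex_of_real ((\<xi> \<bullet> u) * indicator (cball 0 1) u))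
      \<le> norm ((2 + (norm \<xi>)\<^sup>2) * min 1 ((norm u)\<^sup>2))"
    \<comment> \<open>Inside the ball the integrand is a second order Taylor remainder, giving
      \<open>(norm \<xi>)\<^sup>2\<close>; outside it is bounded by 2.\<close>
    proof (cases "norm u \<le> 1")
      case True
      then have m: "min 1 ((norm u)\<^sup>2) = (norm u)\<^sup>2" by (simp add: abs_square_le_1)
      have "norm (iexp (\<xi> \<bullet> u) - 1 - \<i> * complex_of_real ((\<xi> \<bullet> u) * indicator (cball 0 1) u)) \<le> (\<xi> \<bullet> u)\<^sup>2 / 2"
        using True cmod_iexp_linear_le by simp
      also have "\<dots> \<le> (norm \<xi>)\<^sup>2 * (norm u)\<^sup>2"
        using inner_square_le[of \<xi> u] zero_le_power2[of "\<xi> \<bullet> u"] by linarith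
      also have "\<dots> \<le> (2 + (norm \<xi>)\<^sup>2) * (norm u)\<^sup>2" by (simp add: distrib_right)
      finally show ?thesis unfolding m by (simp add: abs_mult)
    next
      case False
      then have m: "min 1 ((norm u)\<^sup>2) = 1" using one_le_power[of "norm u" 2] by auto
      have "cmod (iexp (\<xi> \<bullet> u) - 1) \<le> cmod (iexp (\<xi> \<bullet> u)) + cmod 1" by (rule norm_triangle_ineq4)
      then have "cmod (iexp (\<xi> \<bullet> u) - 1) \<le> 2 + (norm \<xi>)\<^sup>2"
        using zero_le_power2[of "norm \<xi>"] by (simp add: add_increasing2)
      then show ?thesis using False unfolding m by (simp add: abs_of_nonneg)
    qed
  qed
qed

lemma scaled_sin_tendsto: "(\<lambda>n. real (Suc n) * sin (c / real (Suc n))) \<longlonglongrightarrow> c"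
proof (rule LIM_zero_cancel, rule Lim_null_comparison)
  have "\<bar>real (Suc n) * sin (c / real (Suc n)) - c\<bar> \<le> c\<^sup>2 / 2 * inverse (real (Suc n))" for n
  proof -
    have "c\<^sup>2 / (2 * real (Suc n)) = c\<^sup>2 / 2 * inverse (real (Suc n))"
      by (simp add: field_simps del: of_nat_Suc)
    then show ?thesis using abs_scaled_sin_close[of "real (Suc n)" c] by (metis of_nat_0_less_iff zero_less_Suc)
  qed
  then show "\<forall>\<^sub>F n in sequentially. norm (real (Suc n) * sin (c / real (Suc n)) - c)
      \<le> c\<^sup>2 / 2 * inverse (real (Suc n))" by simp
  show "(\<lambda>n. c\<^sup>2 / 2 * inverse (real (Suc n))) \<longlonglongrightarrow> 0"
    by (rule tendsto_mult_right_zero[OF LIMSEQ_inverse_real_of_nat])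
qed

text \<open>The modulus of the characteristic function is \<open>exp (- J \<xi>)\<close>, and the
  second moment of \<open>\<mu>\<close> keeps it close to 1 near the origin, so that
  \<open>J\<close> is at most quadratic there. Rescaling turns \<open>1 - cos\<close> into a square
  in the limit, and Fatou's lemma gives the second moment of \<open>\<nu>\<close> in each
  direction.\<close>

lemma levy_measure_second_moment:
  fixes \<nu> \<mu> :: "'a::euclidean_space measure"
  assumes \<nu>: "levy_measure \<nu>"
    and \<mu>: "prob_space \<mu>" "sets \<mu> = sets borel" "integrable \<mu> (\<lambda>x. (norm x)\<^sup>2)"
    and cf: "\<And>\<xi>. char_fun \<mu> \<xi> = exp (\<i> * complex_of_real (b \<bullet> \<xi>) +
      (\<integral>u. (iexp (\<xi> \<bullet> u) - 1 - \<i> * complex_of_real ((\<xi> \<bullet> u) * indicator (cball 0 1) u)) \<partial>\<nu>))"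
  shows "integrable \<nu> (\<lambda>u. (norm u)\<^sup>2)"
proof -
  interpret \<mu>: prob_space \<mu> by fact
  note [measurable_cong] = levy_measure_sets[OF \<nu>] \<mu>(2)
  define J where "J \<xi> = (\<integral>u. 1 - cos (\<xi> \<bullet> u) \<partial>\<nu>)" for \<xi>
  define s where "s \<xi> = (\<integral>x. (\<xi> \<bullet> x)\<^sup>2 \<partial>\<mu>)" for \<xi>
  have int_J: "integrable \<nu> (\<lambda>u. 1 - cos (\<xi> \<bullet> u))" for \<xi>
  proof -
    have "integrable \<nu> (\<lambda>u. - Re (iexp (\<xi> \<bullet> u) - 1 - \<i> * complex_of_real ((\<xi> \<bullet> u) * indicator (cball 0 1) u)))"
      by (intro integrable_minus integrable_Re integrable_levy_khintchine[OF \<nu>])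
    then show ?thesis by (simp add: Re_exp)
  qed
  have J_nonneg: "0 \<le> J \<xi>" for \<xi> unfolding J_def by (rule integral_nonneg_AE) auto
  have norm_cf: "cmod (char_fun \<mu> \<xi>) = exp (- J \<xi>)" for \<xi>
  proof -
    have "Re (\<integral>u. (iexp (\<xi> \<bullet> u) - 1 - \<i> * complex_of_real ((\<xi> \<bullet> u) * indicator (cball 0 1) u)) \<partial>\<nu>)
        = (\<integral>u. Re (iexp (\<xi> \<bullet> u) - 1 - \<i> * complex_of_real ((\<xi> \<bullet> u) * indicator (cball 0 1) u)) \<partial>\<nu>)"
      by (rule integral_Re[symmetric, OF integrable_levy_khintchine[OF \<nu>]])
    also have "\<dots> = (\<integral>u. - (1 - cos (\<xi> \<bullet> u)) \<partial>\<nu>)" by (simp add: Re_exp)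
    also have "\<dots> = - J \<xi>" unfolding J_def by (rule integral_minus)
    finally show ?thesis unfolding cf by (simp add: norm_exp_eq_Re)
  qed
  have J_le: "J \<xi> \<le> s \<xi>" if s1: "s \<xi> \<le> 1" for \<xi>
  proof -
    have int_e: "integrable \<mu> (\<lambda>x. iexp (\<xi> \<bullet> x))" by (rule \<mu>.integrable_const_bound[of _ 1]) auto
    have int_s: "integrable \<mu> (\<lambda>x. (\<xi> \<bullet> x)\<^sup>2)" by (rule integrable_inner_square[OF \<mu>(2,3)])
    \<comment> \<open>From \<open>1 - s / 2 \<le> exp (- J)\<close> and
      \<open>1 + J \<le> exp J\<close> one gets \<open>(1 - s / 2) * (1 + J) \<le> 1\<close>. The
      resulting term \<open>J * s / 2\<close> is at most \<open>J / 2\<close> since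
      \<open>s \<le> 1\<close>, and is absorbed on the left.\<close>
    have "1 - s \<xi> / 2 = (\<integral>x. 1 - (\<xi> \<bullet> x)\<^sup>2 / 2 \<partial>\<mu>)"
      using int_s by (simp add: s_def \<mu>.prob_space)
    also have "\<dots> \<le> (\<integral>x. Re (iexp (\<xi> \<bullet> x)) \<partial>\<mu>)"
      using int_s integrable_Re[OF int_e] cos_ge_one_minus by (intro integral_mono) (auto simp: Re_exp)
    also have "\<dots> = Re (char_fun \<mu> \<xi>)" unfolding char_fun_def by (rule integral_Re[OF int_e])
    also have "\<dots> \<le> exp (- J \<xi>)" unfolding norm_cf[symmetric] by (rule complex_Re_le_cmod)
    finally have "(1 - s \<xi> / 2) * (1 + J \<xi>) \<le> exp (- J \<xi>) * exp (J \<xi>)"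
      using J_nonneg[of \<xi>] exp_ge_add_one_self[of "J \<xi>"] by (intro mult_mono) auto
    also have "\<dots> = 1" by (simp add: exp_add[symmetric])
    finally have "J \<xi> \<le> s \<xi> / 2 + J \<xi> * s \<xi> / 2" by (simp add: algebra_simps)
    moreover have "J \<xi> * s \<xi> \<le> J \<xi> * 1" using J_nonneg s1 by (intro mult_left_mono) auto
    ultimately show ?thesis by simp
  qed
  have sq: "integrable \<nu> (\<lambda>u. (\<xi> \<bullet> u)\<^sup>2)" for \<xi> :: 'a
  proof -
    \<comment> \<open>This is \<open>(Suc n)\<^sup>2\<close> times \<open>1 - cos\<close> at the
      frequency \<open>\<xi>\<close> divided by \<open>Suc n\<close>, rewritten by the half-angle
      formula so that the limit can be read off from \<open>scaled_sin_tendsto\<close>.\<close>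
    define f where "f n u = 2 * (real (Suc n) * sin ((\<xi> \<bullet> u / 2) / real (Suc n)))\<^sup>2" for n and u :: 'a
    have f: "f n u = (real (Suc n))\<^sup>2 * (1 - cos ((\<xi> /\<^sub>R real (Suc n)) \<bullet> u))" for n u
    proof -
      have e: "(\<xi> /\<^sub>R real (Suc n)) \<bullet> u = 2 * ((\<xi> \<bullet> u / 2) / real (Suc n))"
        by (simp add: field_simps del: of_nat_Suc)
      have "cos ((\<xi> /\<^sub>R real (Suc n)) \<bullet> u) = cos (2 * ((\<xi> \<bullet> u / 2) / real (Suc n)))"
        unfolding e ..
      also have "\<dots> = 1 - 2 * (sin ((\<xi> \<bullet> u / 2) / real (Suc n)))\<^sup>2"
        by (rule cos_double_sin)
      finally show ?thesis by (simp add: f_def power_mult_distrib del: of_nat_Suc)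
    qed
    have lim: "(\<lambda>n. f n u) \<longlonglongrightarrow> 2 * (\<xi> \<bullet> u / 2)\<^sup>2" for u
      unfolding f_def
    proof (intro tendsto_intros)
      show "(\<lambda>n. real (Suc n) * sin ((\<xi> \<bullet> u / 2) / real (Suc n))) \<longlonglongrightarrow> \<xi> \<bullet> u / 2"
        by (rule scaled_sin_tendsto)
    qed
    \<comment> \<open>The condition on \<open>n\<close> makes the rescaled second moment at most 1,
      as \<open>J_le\<close> demands; the factors \<open>(Suc n)\<^sup>2\<close> then cancel and
      leave a bound independent of \<open>n\<close>.\<close>
    have f_int: "(\<integral>\<^sup>+u. ennreal (f n u) \<partial>\<nu>) \<le> ennreal (s \<xi>)" if n: "s \<xi> \<le> real n" for n
    proof -
      have sn: "s (\<xi> /\<^sub>R real (Suc n)) = s \<xi> / (real (Suc n))\<^sup>2"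
        unfolding s_def by (simp add: power_mult_distrib power_inverse field_simps del: of_nat_Suc)
      have "real n \<le> (real (Suc n))\<^sup>2" by (simp add: power2_eq_square algebra_simps)
      then have "s (\<xi> /\<^sub>R real (Suc n)) \<le> 1" unfolding sn using n by (simp add: divide_le_eq_1)
      from J_le[OF this] have "(real (Suc n))\<^sup>2 * J (\<xi> /\<^sub>R real (Suc n)) \<le> s \<xi>"
        unfolding sn by (simp add: le_divide_eq mult.commute del: of_nat_Suc)
      moreover have "(\<integral>\<^sup>+u. ennreal (f n u) \<partial>\<nu>) = ennreal ((real (Suc n))\<^sup>2 * J (\<xi> /\<^sub>R real (Suc n)))"
        unfolding f J_def
        by (subst nn_integral_eq_integral) (auto intro!: integrable_mult_right int_J simp del: of_nat_Suc inner_scaleR_left)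
      ultimately show ?thesis by (simp add: ennreal_leI)
    qed
    have "(\<integral>\<^sup>+u. ennreal (2 * (\<xi> \<bullet> u / 2)\<^sup>2) \<partial>\<nu>) = (\<integral>\<^sup>+u. liminf (\<lambda>n. ennreal (f n u)) \<partial>\<nu>)"
      using lim by (intro nn_integral_cong lim_imp_Liminf[symmetric]) auto
    also have "\<dots> \<le> liminf (\<lambda>n. \<integral>\<^sup>+u. ennreal (f n u) \<partial>\<nu>)"
      by (rule nn_integral_liminf) (auto simp: f_def)
    also have "\<dots> \<le> ennreal (s \<xi>)"
    proof -
      obtain N where N: "s \<xi> \<le> real N" using real_arch_simple by blast
      have "liminf (\<lambda>n. \<integral>\<^sup>+u. ennreal (f n u) \<partial>\<nu>) \<le> liminf (\<lambda>n. ennreal (s \<xi>))"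
        by (rule Liminf_mono, rule eventually_sequentiallyI[of N]) (use N f_int in force)
      then show ?thesis by (simp add: Liminf_const)
    qed
    also have "\<dots> < \<infinity>" by simp
    finally have "integrable \<nu> (\<lambda>u. 2 * (\<xi> \<bullet> u / 2)\<^sup>2)" by (intro integrableI_nonneg) auto
    then have "integrable \<nu> (\<lambda>u. 2 * (2 * (\<xi> \<bullet> u / 2)\<^sup>2))" by (rule integrable_mult_right)
    then show ?thesis by (simp add: power_divide)
  qed
  have "(norm u)\<^sup>2 = (\<Sum>i\<in>Basis. (i \<bullet> u)\<^sup>2)" for u :: 'a
    unfolding power2_norm_eq_inner euclidean_inner[of u u] by (simp add: power2_eq_square inner_commute)
  then show ?thesis using sq by simp
qed

text \<open>Passing to full compensation changes the drift into \<open>\<beta>\<close>, which is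
  linear along rays. The derivative at 0 of the characteristic function along \<open>\<xi>\<close>
  is then \<open>\<i> * \<beta> \<xi>\<close>, because that of \<open>levy_exponent\<close> vanishes
  there; computed from the law it is 0 by centering.\<close>

lemma centered_char_fun_eq:
  fixes \<nu> \<mu> :: "'a::euclidean_space measure"
  assumes \<nu>: "levy_measure \<nu>"
    and \<mu>: "prob_space \<mu>" "sets \<mu> = sets borel" "integrable \<mu> (\<lambda>x. (norm x)\<^sup>2)" "(\<integral>x. x \<partial>\<mu>) = 0"
    and cf: "\<And>\<xi>. char_fun \<mu> \<xi> = exp (\<i> * complex_of_real (b \<bullet> \<xi>) +
      (\<integral>u. (iexp (\<xi> \<bullet> u) - 1 - \<i> * complex_of_real ((\<xi> \<bullet> u) * indicator (cball 0 1) u)) \<partial>\<nu>))"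
  shows "char_fun \<mu> \<xi> = exp (levy_exponent \<nu> \<xi>)"
proof -
  note [measurable_cong] = levy_measure_sets[OF \<nu>]
  have sq: "integrable \<nu> (\<lambda>u. (norm u)\<^sup>2)" by (rule levy_measure_second_moment[OF \<nu> \<mu>(1-3) cf])
  \<comment> \<open>The large-jump part of the compensator. Off the unit ball
    \<open>norm u \<le> (norm u)\<^sup>2\<close>, so the second moment makes it integrable.\<close>
  define d where "d \<xi> u = (\<xi> \<bullet> u) * (1 - indicator (cball 0 1) u)" for \<xi> u :: 'a
  have [measurable]: "cball (0::'a) 1 \<in> sets borel" by simp
  have d_int: "integrable \<nu> (d \<xi>)" for \<xi>
  proof (rule Bochner_Integration.integrable_bound[OF integrable_mult_right[OF sq, of "norm \<xi>"]])
    show "AE u in \<nu>. norm (d \<xi> u) \<le> norm (norm \<xi> * (norm u)\<^sup>2)"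
    proof (rule AE_I2)
      fix u
      show "norm (d \<xi> u) \<le> norm (norm \<xi> * (norm u)\<^sup>2)"
      proof (cases "norm u \<le> 1")
        case False
        have "\<bar>\<xi> \<bullet> u\<bar> \<le> norm \<xi> * norm u" by (rule Cauchy_Schwarz_ineq2)
        also have "\<dots> \<le> norm \<xi> * (norm u)\<^sup>2"
          using False power_increasing[of 1 2 "norm u"] by (intro mult_left_mono) auto
        finally show ?thesis using False by (simp add: d_def abs_mult)
      qed (simp add: d_def)
    qed
    show "d \<xi> \<in> borel_measurable \<nu>" unfolding d_def by measurable
  qed
  define \<beta> where "\<beta> \<xi> = b \<bullet> \<xi> + (\<integral>u. d \<xi> u \<partial>\<nu>)" for \<xi>
  have \<beta>_scale: "\<beta> (t *\<^sub>R \<xi>) = t * \<beta> \<xi>" for t \<xi>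
    unfolding \<beta>_def d_def by (simp add: distrib_left mult.assoc)
  have cf': "char_fun \<mu> \<xi> = exp (\<i> * complex_of_real (\<beta> \<xi>) + levy_exponent \<nu> \<xi>)" for \<xi>
  proof -
    have "(\<integral>u. (iexp (\<xi> \<bullet> u) - 1 - \<i> * complex_of_real ((\<xi> \<bullet> u) * indicator (cball 0 1) u)) \<partial>\<nu>)
       = (\<integral>u. (iexp (\<xi> \<bullet> u) - 1 - \<i> * complex_of_real (\<xi> \<bullet> u)) + \<i> * complex_of_real (d \<xi> u) \<partial>\<nu>)"
      by (rule Bochner_Integration.integral_cong) (auto simp: d_def indicator_def)
    also have "\<dots> = levy_exponent \<nu> \<xi> + \<i> * complex_of_real (\<integral>u. d \<xi> u \<partial>\<nu>)"
      unfolding levy_exponent_def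
      using integrable_levy_exponent[OF levy_measure_sets[OF \<nu>] sq] d_int
      by (subst Bochner_Integration.integral_add) auto
    finally show ?thesis unfolding cf \<beta>_def by (simp add: algebra_simps)
  qed
  have "\<beta> \<xi> = 0"
  proof -
    have "((\<lambda>s. \<i> * complex_of_real (s * \<beta> \<xi>)) has_vector_derivative \<i> * complex_of_real (\<beta> \<xi>)) (at 0)"
      by (auto intro!: derivative_eq_intros)
    from has_vector_derivative_add[OF this
        has_vector_derivative_levy_exponent[OF levy_measure_sets[OF \<nu>] sq, of \<xi> 0]]
    have "((\<lambda>s. \<i> * complex_of_real (s * \<beta> \<xi>) + levy_exponent \<nu> (s *\<^sub>R \<xi>))
        has_vector_derivative \<i> * complex_of_real (\<beta> \<xi>)) (at 0)" by simp
    from field_vector_diff_chain_at[OF this DERIV_exp]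
    have 1: "((\<lambda>s. char_fun \<mu> (s *\<^sub>R \<xi>)) has_vector_derivative \<i> * complex_of_real (\<beta> \<xi>)) (at 0)"
      by (simp add: o_def cf' \<beta>_scale levy_exponent_def)
    have "((\<lambda>s. char_fun \<mu> (s *\<^sub>R \<xi>)) has_vector_derivative
        (\<integral>u. \<i> * complex_of_real (\<xi> \<bullet> u) * iexp (0 * (\<xi> \<bullet> u)) \<partial>\<mu>)) (at 0)"
      by (rule has_vector_derivative_char_fun[OF \<mu>(1-3)])
    moreover have "(\<integral>u. \<i> * complex_of_real (\<xi> \<bullet> u) * iexp (0 * (\<xi> \<bullet> u)) \<partial>\<mu>) = 0"
      using integral_inner_right[of \<xi> \<mu> "\<lambda>u. u"] integrable_inner(1)[OF \<mu>(1-3)] \<mu>(4)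
      by simp
    ultimately have "((\<lambda>s. char_fun \<mu> (s *\<^sub>R \<xi>)) has_vector_derivative 0) (at 0)" by simp
    from vector_derivative_unique_at[OF 1 this] show ?thesis by simp
  qed
  then show ?thesis using cf'[of \<xi>] by simp
qed

section \<open>Interpolation between the two laws\<close>

text \<open>Boundedness lets these fields be averaged over any probability law; the Lipschitz
  condition makes their increments square integrable over jumps.\<close>

definition bounded_lipschitz :: "('a::euclidean_space \<Rightarrow> 'a) \<Rightarrow> bool" where
  "bounded_lipschitz f \<longleftrightarrow> (\<exists>B. \<forall>x. norm (f x) \<le> B) \<and> (\<exists>K. \<forall>x y. norm (f x - f y) \<le> K * norm (x - y))"

lemma lipschitz_measurable:
  fixes f :: "'a::euclidean_space \<Rightarrow> 'a"
  assumes "\<And>x y. norm (f x - f y) \<le> K * norm (x - y)"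
  shows "f \<in> borel_measurable borel"
proof (rule borel_measurable_continuous_onI)
  have "(max K 0)-lipschitz_on UNIV f"
  proof (rule lipschitz_onI)
    fix x y :: 'a
    have "K * norm (x - y) \<le> max K 0 * norm (x - y)" by (intro mult_right_mono) auto
    then show "dist (f x) (f y) \<le> max K 0 * dist x y"
      using assms[of x y] by (simp add: dist_norm)
  qed simp
  then show "continuous_on UNIV f" by (rule lipschitz_on_continuous_on)
qed

lemma bounded_lipschitz_measurable: "bounded_lipschitz f \<Longrightarrow> f \<in> borel_measurable borel"
  unfolding bounded_lipschitz_def using lipschitz_measurable by blast

lemma bounded_lipschitz_add:
  assumes "bounded_lipschitz f" "bounded_lipschitz g"
  shows "bounded_lipschitz (\<lambda>x. f x + g x)"
proof -
  obtain B K B' K' where b: "\<And>x. norm (f x) \<le> B" "\<And>x. norm (g x) \<le> B'"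
    "\<And>x y. norm (f x - f y) \<le> K * norm (x - y)" "\<And>x y. norm (g x - g y) \<le> K' * norm (x - y)"
    using assms unfolding bounded_lipschitz_def by blast
  have "norm (f x + g x) \<le> B + B'" for x using b by (intro norm_triangle_mono) auto
  moreover have "norm (f x + g x - (f y + g y)) \<le> (K + K') * norm (x - y)" for x y
    using norm_triangle_mono[OF b(3)[of x y] b(4)[of x y]] by (simp add: algebra_simps)
  ultimately show ?thesis unfolding bounded_lipschitz_def by blast
qed

lemma cmod_iexp_diff_le: "cmod (iexp s - iexp t) \<le> \<bar>s - t\<bar>"
proof -
  have "iexp s - iexp t = iexp t * (iexp (s - t) - 1)"
    by (simp add: right_diff_distrib exp_diff)
  then show ?thesis using cmod_iexp_diff_one_le[of "s - t"] by (simp add: norm_mult)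
qed

section \<open>The interpolating laws\<close>

text \<open>Here \<open>\<mu>\<close> stands for the law of X and \<open>\<eta>\<close> for the law
  of Y; the exponent is already in its fully compensated form.\<close>

locale self_decomposable_comparison =
  fixes \<mu> \<nu> \<eta> :: "'a::euclidean_space measure"
  assumes prob_\<mu>: "prob_space \<mu>" and sets_\<mu>: "sets \<mu> = sets borel"
    and prob_\<eta>: "prob_space \<eta>" and sets_\<eta>: "sets \<eta> = sets borel"
    and square_\<eta>: "integrable \<eta> (\<lambda>y. (norm y)\<^sup>2)"
    and sigma_finite_\<nu>: "sigma_finite_measure \<nu>" and sets_\<nu>: "sets \<nu> = sets borel"
    and square_\<nu>: "integrable \<nu> (\<lambda>u. (norm u)\<^sup>2)"
    and char_fun_\<mu>: "\<And>\<xi>. char_fun \<mu> \<xi> = exp (levy_exponent \<nu> \<xi>)"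
    and self_decomposable_\<mu>: "self_decomposable \<mu>"
begin

sublocale \<mu>: prob_space \<mu> by (rule prob_\<mu>)
sublocale \<eta>: prob_space \<eta> by (rule prob_\<eta>)
sublocale \<nu>: sigma_finite_measure \<nu> by (rule sigma_finite_\<nu>)
sublocale \<nu>\<eta>: pair_sigma_finite \<nu> \<eta> ..

declare sets_\<mu>[measurable_cong] sets_\<eta>[measurable_cong] sets_\<nu>[measurable_cong]

text \<open>The law of Z_c for c = \<open>\<gamma>\<close>, chosen separately for each
  \<open>\<gamma>\<close>. How it varies with \<open>\<gamma>\<close> is visible only through its
  characteristic function.\<close>

definition cofactor :: "real \<Rightarrow> 'a measure" where
  "cofactor \<gamma> = (SOME \<rho>. prob_space \<rho> \<and> sets \<rho> = sets borel \<and>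
     (\<forall>\<xi>. char_fun \<rho> \<xi> = char_fun \<mu> \<xi> / char_fun \<mu> (\<gamma> *\<^sub>R \<xi>)))"

lemma cofactor:
  assumes "\<gamma> \<in> {0<..<1}"
  shows "prob_space (cofactor \<gamma>)" "sets (cofactor \<gamma>) = sets borel"
    "char_fun (cofactor \<gamma>) \<xi> = exp (levy_exponent \<nu> \<xi> - levy_exponent \<nu> (\<gamma> *\<^sub>R \<xi>))"
proof -
  have "\<exists>\<rho> :: 'a measure. prob_space \<rho> \<and> sets \<rho> = sets borel \<and>
     (\<forall>\<xi>. char_fun \<rho> \<xi> = char_fun \<mu> \<xi> / char_fun \<mu> (\<gamma> *\<^sub>R \<xi>))"
    using self_decomposable_\<mu> assms unfolding self_decomposable_def by blast
  from someI_ex[OF this] show "prob_space (cofactor \<gamma>)" "sets (cofactor \<gamma>) = sets borel"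
    "char_fun (cofactor \<gamma>) \<xi> = exp (levy_exponent \<nu> \<xi> - levy_exponent \<nu> (\<gamma> *\<^sub>R \<xi>))"
    unfolding cofactor_def by (auto simp: char_fun_\<mu> exp_diff)
qed

text \<open>When \<open>H\<close> is the gradient of \<open>h\<close>, multiplying this field by
  \<open>\<gamma>\<close> gives the gradient of y \<mapsto> E h(\<gamma>y + Z).\<close>

definition smoothed_gradient :: "('a \<Rightarrow> 'a) \<Rightarrow> real \<Rightarrow> 'a \<Rightarrow> 'a" where
  "smoothed_gradient H \<gamma> y = (\<integral>z. H (\<gamma> *\<^sub>R y + z) \<partial>cofactor \<gamma>)"

lemma integrable_cofactor:
  fixes f :: "'a \<Rightarrow> 'b::{banach,second_countable_topology}"
  assumes "\<gamma> \<in> {0<..<1}" "f \<in> borel_measurable borel" "\<And>x. norm (f x) \<le> B"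
  shows "integrable (cofactor \<gamma>) (\<lambda>z. f (x + z))"
  using integrable_shift_bounded[OF cofactor(1,2)[OF assms(1)] assms(2,3)] .

lemma smoothed_gradient_lipschitz:
  assumes \<gamma>: "\<gamma> \<in> {0<..<1}" and H: "\<And>x. norm (H x) \<le> B"
    and L: "\<And>x y. norm (H x - H y) \<le> L * norm (x - y)"
  shows "norm (smoothed_gradient H \<gamma> x) \<le> B"
    and "norm (smoothed_gradient H \<gamma> x - smoothed_gradient H \<gamma> y) \<le> \<gamma> * L * norm (x - y)"
proof -
  interpret c: prob_space "cofactor \<gamma>" by (rule cofactor(1)[OF \<gamma>])
  note i = integrable_cofactor[OF \<gamma> lipschitz_measurable[OF L] H]
  have "norm (smoothed_gradient H \<gamma> x) \<le> (\<integral>z. norm (H (\<gamma> *\<^sub>R x + z)) \<partial>cofactor \<gamma>)"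
    unfolding smoothed_gradient_def by (rule integral_norm_bound)
  also have "\<dots> \<le> (\<integral>z. B \<partial>cofactor \<gamma>)" using i H by (intro integral_mono) auto
  finally show "norm (smoothed_gradient H \<gamma> x) \<le> B" by (simp add: c.prob_space)
  have "smoothed_gradient H \<gamma> x - smoothed_gradient H \<gamma> y
      = (\<integral>z. H (\<gamma> *\<^sub>R x + z) - H (\<gamma> *\<^sub>R y + z) \<partial>cofactor \<gamma>)"
    unfolding smoothed_gradient_def using i by simp
  also have "norm \<dots> \<le> (\<integral>z. norm (H (\<gamma> *\<^sub>R x + z) - H (\<gamma> *\<^sub>R y + z)) \<partial>cofactor \<gamma>)"
    by (rule integral_norm_bound)
  also have "\<dots> \<le> (\<integral>z. \<gamma> * L * norm (x - y) \<partial>cofactor \<gamma>)"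
  proof (rule integral_mono)
    fix z
    have "norm (H (\<gamma> *\<^sub>R x + z) - H (\<gamma> *\<^sub>R y + z)) \<le> L * norm (\<gamma> *\<^sub>R (x - y))"
      using L[of "\<gamma> *\<^sub>R x + z" "\<gamma> *\<^sub>R y + z"] by (simp add: scaleR_diff_right)
    then show "norm (H (\<gamma> *\<^sub>R x + z) - H (\<gamma> *\<^sub>R y + z)) \<le> \<gamma> * L * norm (x - y)"
      using \<gamma> by (simp add: mult_ac)
  qed (use i in auto)
  finally show "norm (smoothed_gradient H \<gamma> x - smoothed_gradient H \<gamma> y) \<le> \<gamma> * L * norm (x - y)"
    by (simp add: c.prob_space)
qed

lemma bounded_lipschitz_smoothed_gradient:
  assumes "\<gamma> \<in> {0<..<1}" "bounded_lipschitz H"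
  shows "bounded_lipschitz (smoothed_gradient H \<gamma>)"
proof -
  obtain B K where "\<And>x. norm (H x) \<le> B" "\<And>x y. norm (H x - H y) \<le> K * norm (x - y)"
    using assms(2) unfolding bounded_lipschitz_def by blast
  from smoothed_gradient_lipschitz[OF assms(1) this] show ?thesis
    unfolding bounded_lipschitz_def by blast
qed

section \<open>Jump increments and the Stein discrepancy\<close>

abbreviation increment :: "('a \<Rightarrow> 'a) \<Rightarrow> 'a \<times> 'a \<Rightarrow> 'a" where
  "increment f p \<equiv> f (snd p + fst p) - f (snd p)"

text \<open>The defect of Y in the covariance identity E<X; g(X)> = E \<integral> <g(X+u) - g(X); u>
  \<nu>(du) of the target law. In a pair, the first component is the jump and the second the base
  point.\<close>

definition stein_discrepancy :: "('a \<Rightarrow> 'a) \<Rightarrow> real" where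
  "stein_discrepancy g = (\<integral>y. y \<bullet> g y \<partial>\<eta>) - (\<integral>p. increment g p \<bullet> fst p \<partial>(\<nu> \<Otimes>\<^sub>M \<eta>))"

lemma integrable_fst:
  fixes f :: "'a \<Rightarrow> 'b::{banach,second_countable_topology}"
  assumes "integrable \<nu> f"
  shows "integrable (\<nu> \<Otimes>\<^sub>M \<eta>) (\<lambda>p. f (fst p))" "(\<integral>p. f (fst p) \<partial>(\<nu> \<Otimes>\<^sub>M \<eta>)) = (\<integral>u. f u \<partial>\<nu>)"
proof -
  have d: "distr (\<nu> \<Otimes>\<^sub>M \<eta>) \<nu> fst = \<nu>" by (rule \<eta>.distr_pair_fst)
  have m[measurable]: "f \<in> borel_measurable \<nu>" using assms by simp
  have "integrable (distr (\<nu> \<Otimes>\<^sub>M \<eta>) \<nu> fst) f" using assms by (simp add: d)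
  then show "integrable (\<nu> \<Otimes>\<^sub>M \<eta>) (\<lambda>p. f (fst p))" by (subst (asm) integrable_distr_eq) auto
  have "(\<integral>p. f (fst p) \<partial>(\<nu> \<Otimes>\<^sub>M \<eta>)) = (\<integral>u. f u \<partial>distr (\<nu> \<Otimes>\<^sub>M \<eta>) \<nu> fst)"
    by (rule integral_distr[symmetric]) auto
  then show "(\<integral>p. f (fst p) \<partial>(\<nu> \<Otimes>\<^sub>M \<eta>)) = (\<integral>u. f u \<partial>\<nu>)" by (simp add: d)
qed

text \<open>Lipschitz increments are at most linear in the jump, so their product is dominated by a
  multiple of its squared norm, uniformly in the base point.\<close>

lemma integrable_increments:
  assumes f: "\<And>x y. norm (f x - f y) \<le> K * norm (x - y)" and g: "\<And>x y. norm (g x - g y) \<le> K' * norm (x - y)"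
  shows "integrable (\<nu> \<Otimes>\<^sub>M \<eta>) (\<lambda>p. increment f p \<bullet> increment g p)"
proof (rule Bochner_Integration.integrable_bound[OF integrable_mult_right[OF integrable_fst(1)[OF square_\<nu>], of "K * K'"]])
  note [measurable] = lipschitz_measurable[of f, OF f] lipschitz_measurable[of g, OF g]
  show "(\<lambda>p. increment f p \<bullet> increment g p) \<in> borel_measurable (\<nu> \<Otimes>\<^sub>M \<eta>)" by measurable
  show "AE p in \<nu> \<Otimes>\<^sub>M \<eta>. norm (increment f p \<bullet> increment g p) \<le> norm (K * K' * (norm (fst p))\<^sup>2)"
  proof (rule AE_I2)
    fix p :: "'a \<times> 'a"
    have "\<bar>increment f p \<bullet> increment g p\<bar> \<le> norm (increment f p) * norm (increment g p)"
      by (rule Cauchy_Schwarz_ineq2)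
    also have "\<dots> \<le> (K * norm (fst p)) * (K' * norm (fst p))"
      using f[of "snd p + fst p" "snd p"] g[of "snd p + fst p" "snd p"]
      by (intro mult_mono) (auto intro: order_trans[OF norm_ge_zero])
    also have "\<dots> \<le> norm (K * K' * (norm (fst p))\<^sup>2)" by (simp add: power2_eq_square mult_ac)
    finally show "norm (increment f p \<bullet> increment g p) \<le> norm (K * K' * (norm (fst p))\<^sup>2)" by simp
  qed
qed

lemma integrable_inner_lipschitz:
  fixes g :: "'a \<Rightarrow> 'a"
  assumes g: "\<And>x y. norm (g x - g y) \<le> K * norm (x - y)"
  shows "integrable \<eta> (\<lambda>y. (norm (g y))\<^sup>2)" "integrable \<eta> (\<lambda>y. y \<bullet> g y)" "integrable \<eta> g"
proof -
  note [measurable] = lipschitz_measurable[of g, OF g]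
  have bd: "(norm (g y))\<^sup>2 \<le> 2 * (norm (g 0))\<^sup>2 + 2 * K\<^sup>2 * (norm y)\<^sup>2" for y
  proof -
    have "norm (g y) \<le> norm (g 0) + norm (g y - g 0)" by (rule norm_triangle_sub)
    also have "\<dots> \<le> norm (g 0) + K * norm y" using g[of y 0] by simp
    finally have "(norm (g y))\<^sup>2 \<le> (norm (g 0) + K * norm y)\<^sup>2" by (intro power_mono) auto
    also have "\<dots> \<le> 2 * (norm (g 0))\<^sup>2 + 2 * K\<^sup>2 * (norm y)\<^sup>2"
      using zero_le_power2[of "norm (g 0) - K * norm y"]
      by (simp add: power2_sum power2_diff power_mult_distrib)
    finally show ?thesis .
  qed
  show sq: "integrable \<eta> (\<lambda>y. (norm (g y))\<^sup>2)"
    by (rule Bochner_Integration.integrable_bound[OF Bochner_Integration.integrable_add[OF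
        \<eta>.integrable_const[of "2 * (norm (g 0))\<^sup>2"] integrable_mult_right[OF square_\<eta>, of "2 * K\<^sup>2"]]])
       (use bd in auto)
  show "integrable \<eta> (\<lambda>y. y \<bullet> g y)"
  proof (rule Bochner_Integration.integrable_bound[OF Bochner_Integration.integrable_add[OF square_\<eta> sq]])
    show "AE y in \<eta>. norm (y \<bullet> g y) \<le> norm ((norm y)\<^sup>2 + (norm (g y))\<^sup>2)"
    proof (rule AE_I2)
      fix y
      have "2 * \<bar>y \<bullet> g y\<bar> \<le> 2 * (norm y * norm (g y))"
        using Cauchy_Schwarz_ineq2[of y "g y"] by simp
      also have "\<dots> \<le> (norm y)\<^sup>2 + (norm (g y))\<^sup>2"
        using sum_squares_bound[of "norm y" "norm (g y)"] by (simp add: mult.assoc)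
      finally show "norm (y \<bullet> g y) \<le> norm ((norm y)\<^sup>2 + (norm (g y))\<^sup>2)"
        by (simp add: abs_of_nonneg)
    qed
  qed measurable
  have le: "a \<le> 1 + a\<^sup>2" for a :: real
    using zero_le_power2[of "a - 1"] zero_le_power2[of "a + 1"] by (simp add: power2_eq_square algebra_simps)
  show "integrable \<eta> g"
    by (rule Bochner_Integration.integrable_bound[OF Bochner_Integration.integrable_add[OF \<eta>.integrable_const[of 1] sq]])
       (auto simp: le)
qed

lemma integrable_increment_inner_fst:
  assumes g: "\<And>x y. norm (g x - g y) \<le> K * norm (x - y)"
  shows "integrable (\<nu> \<Otimes>\<^sub>M \<eta>) (\<lambda>p. increment g p \<bullet> fst p)"
  using integrable_increments[of g K "\<lambda>x. x" 1, OF g] by simp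

lemma stein_discrepancy_add:
  assumes "bounded_lipschitz f" "bounded_lipschitz g"
  shows "stein_discrepancy (\<lambda>x. f x + g x) = stein_discrepancy f + stein_discrepancy g"
proof -
  obtain K K' where f: "\<And>x y. norm (f x - f y) \<le> K * norm (x - y)"
    and g: "\<And>x y. norm (g x - g y) \<le> K' * norm (x - y)"
    using assms unfolding bounded_lipschitz_def by blast
  have "(\<integral>y. y \<bullet> (f y + g y) \<partial>\<eta>) = (\<integral>y. y \<bullet> f y \<partial>\<eta>) + (\<integral>y. y \<bullet> g y \<partial>\<eta>)"
    unfolding inner_add_right
    by (rule Bochner_Integration.integral_add[OF integrable_inner_lipschitz(2)[OF f] integrable_inner_lipschitz(2)[OF g]])
  moreover have "(\<integral>p. increment (\<lambda>x. f x + g x) p \<bullet> fst p \<partial>(\<nu> \<Otimes>\<^sub>M \<eta>))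
      = (\<integral>p. increment f p \<bullet> fst p + increment g p \<bullet> fst p \<partial>(\<nu> \<Otimes>\<^sub>M \<eta>))"
    by (rule Bochner_Integration.integral_cong) (auto simp: algebra_simps)
  moreover have "\<dots> = (\<integral>p. increment f p \<bullet> fst p \<partial>(\<nu> \<Otimes>\<^sub>M \<eta>)) + (\<integral>p. increment g p \<bullet> fst p \<partial>(\<nu> \<Otimes>\<^sub>M \<eta>))"
    by (rule Bochner_Integration.integral_add[OF integrable_increment_inner_fst[OF f] integrable_increment_inner_fst[OF g]])
  ultimately show ?thesis unfolding stein_discrepancy_def by simp
qed


text \<open>
  The curve is \<open>G \<gamma> = E h (\<gamma> Y + Z)\<close> with \<open>Z\<close> distributed according to \<open>cofactor \<gamma>\<close> and independent of \<open>Y\<close>.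
\<close>

definition interpolable :: "('a \<Rightarrow> real) \<Rightarrow> bool" where
  "interpolable h \<longleftrightarrow> (\<exists>H G. bounded_lipschitz H \<and>
     (\<forall>x. (h has_derivative (\<lambda>w. H x \<bullet> w)) (at x)) \<and>
     continuous_on {0..1} G \<and> G 0 = (\<integral>x. h x \<partial>\<mu>) \<and> G 1 = (\<integral>y. h y \<partial>\<eta>) \<and>
     (\<forall>\<gamma>\<in>{0<..<1}. (G has_real_derivative stein_discrepancy (smoothed_gradient H \<gamma>)) (at \<gamma>)))"

lemma integral_monomial:
  assumes "prob_space M" "sets M = sets borel"
  shows "(\<integral>x. Re (c * iexp (\<xi> \<bullet> x)) \<partial>M) = Re (c * char_fun M \<xi>)"
proof -
  have "integrable M (\<lambda>x. iexp (\<xi> \<bullet> x))"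
    using integrable_shift_bounded[OF assms, of "\<lambda>z. iexp (\<xi> \<bullet> z)" 1 0] by simp
  then have "(\<integral>x. Re (c * iexp (\<xi> \<bullet> x)) \<partial>M) = Re (\<integral>x. c * iexp (\<xi> \<bullet> x) \<partial>M)"
    by (intro integral_Re integrable_mult_right)
  then show ?thesis by (simp add: char_fun_def)
qed

text \<open>At one frequency, independence makes the curve a product of characteristic functions.
  Differentiating the factor of \<open>\<eta>\<close> brings down \<open>\<xi> \<bullet> y\<close>
  and gives the first term of \<open>stein_discrepancy\<close>; differentiating \<open>m\<close>
  gives \<open>- \<psi>' \<gamma> * m \<gamma>\<close>, whose integrand contains the increment of
  the exponential, and hence the jump term.\<close>

lemma interpolable_monomial: "interpolable (\<lambda>x. Re (c * iexp (\<xi> \<bullet> x)))"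
proof -
  define H where "H x = Re (c * \<i> * iexp (\<xi> \<bullet> x)) *\<^sub>R \<xi>" for x :: 'a
  \<comment> \<open>On the open interval this is the characteristic function of
    \<open>cofactor \<gamma>\<close> at \<open>\<xi>\<close>, but the formula makes sense for every
    \<open>\<gamma>\<close>. This yields continuity up to the end points, where it equals
    \<open>char_fun \<mu> \<xi>\<close> and 1.\<close>
  define m where "m \<gamma> = exp (levy_exponent \<nu> \<xi> - levy_exponent \<nu> (\<gamma> *\<^sub>R \<xi>))" for \<gamma>
  define G where "G \<gamma> = Re (c * (m \<gamma> * char_fun \<eta> (\<gamma> *\<^sub>R \<xi>)))" for \<gamma>
  define \<phi>' where "\<phi>' \<gamma> = (\<integral>y. \<i> * complex_of_real (\<xi> \<bullet> y) * iexp (\<gamma> * (\<xi> \<bullet> y)) \<partial>\<eta>)" for \<gamma>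
  define \<psi>' where "\<psi>' \<gamma> = (\<integral>u. \<i> * complex_of_real (\<xi> \<bullet> u) * (iexp (\<gamma> * (\<xi> \<bullet> u)) - 1) \<partial>\<nu>)" for \<gamma>
  have H_bl: "bounded_lipschitz H"
  proof -
    have "norm (H x) \<le> cmod c * norm \<xi>" for x
      using abs_Re_le_cmod[of "c * \<i> * iexp (\<xi> \<bullet> x)"] unfolding H_def
      by (simp add: norm_mult mult_right_mono del: times_complex.sel)
    moreover have "norm (H x - H y) \<le> (cmod c * norm \<xi> * norm \<xi>) * norm (x - y)" for x y
    proof -
      have "H x - H y = Re (c * \<i> * (iexp (\<xi> \<bullet> x) - iexp (\<xi> \<bullet> y))) *\<^sub>R \<xi>"
        unfolding H_def scaleR_diff_left[symmetric] minus_complex.sel(1)[symmetric] right_diff_distrib ..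
      then have "norm (H x - H y) = \<bar>Re (c * \<i> * (iexp (\<xi> \<bullet> x) - iexp (\<xi> \<bullet> y)))\<bar> * norm \<xi>"
        by (simp only: norm_scaleR)
      also have "\<dots> \<le> cmod (c * \<i> * (iexp (\<xi> \<bullet> x) - iexp (\<xi> \<bullet> y))) * norm \<xi>"
        by (intro mult_right_mono abs_Re_le_cmod) auto
      also have "\<dots> \<le> cmod c * (norm \<xi> * norm (x - y)) * norm \<xi>"
      proof -
        have "cmod (iexp (\<xi> \<bullet> x) - iexp (\<xi> \<bullet> y)) \<le> \<bar>\<xi> \<bullet> x - \<xi> \<bullet> y\<bar>" by (rule cmod_iexp_diff_le)
        also have "\<dots> \<le> norm \<xi> * norm (x - y)"
          using Cauchy_Schwarz_ineq2[of \<xi> "x - y"] by (simp add: inner_diff_right)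
        finally show ?thesis by (simp add: norm_mult mult_left_mono mult_right_mono)
      qed
      finally show ?thesis by (simp add: mult_ac)
    qed
    ultimately show ?thesis unfolding bounded_lipschitz_def by blast
  qed
  have H_grad: "((\<lambda>x. Re (c * iexp (\<xi> \<bullet> x))) has_derivative (\<lambda>w. H x \<bullet> w)) (at x)" for x
  proof -
    have "((\<lambda>x. Re c * cos (\<xi> \<bullet> x) - Im c * sin (\<xi> \<bullet> x)) has_derivative
        (\<lambda>w. (- Re c * sin (\<xi> \<bullet> x) - Im c * cos (\<xi> \<bullet> x)) * (\<xi> \<bullet> w))) (at x)"
      by (auto intro!: derivative_eq_intros simp: algebra_simps)
    moreover have "(\<lambda>w. H x \<bullet> w) = (\<lambda>w. (- Re c * sin (\<xi> \<bullet> x) - Im c * cos (\<xi> \<bullet> x)) * (\<xi> \<bullet> w))"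
      by (rule ext) (simp add: H_def Re_exp Im_exp algebra_simps)
    moreover have "(\<lambda>x. Re (c * iexp (\<xi> \<bullet> x))) = (\<lambda>x. Re c * cos (\<xi> \<bullet> x) - Im c * sin (\<xi> \<bullet> x))"
      by (simp add: Re_exp Im_exp)
    ultimately show ?thesis by (simp only:)
  qed
  have G_vd: "((\<lambda>\<gamma>. c * (m \<gamma> * char_fun \<eta> (\<gamma> *\<^sub>R \<xi>))) has_vector_derivative
      c * (m \<gamma> * \<phi>' \<gamma> - m \<gamma> * \<psi>' \<gamma> * char_fun \<eta> (\<gamma> *\<^sub>R \<xi>))) (at \<gamma>)" for \<gamma>
  proof -
    have "((\<lambda>\<gamma>. levy_exponent \<nu> \<xi> - levy_exponent \<nu> (\<gamma> *\<^sub>R \<xi>)) has_vector_derivative (0 - \<psi>' \<gamma>)) (at \<gamma>)"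
      unfolding \<psi>'_def
      by (intro has_vector_derivative_diff has_vector_derivative_const
          has_vector_derivative_levy_exponent[OF sets_\<nu> square_\<nu>])
    from field_vector_diff_chain_at[OF this DERIV_exp]
    have m: "(m has_vector_derivative (- \<psi>' \<gamma> * m \<gamma>)) (at \<gamma>)"
      unfolding o_def m_def[symmetric] by simp
    have "((\<lambda>\<gamma>. char_fun \<eta> (\<gamma> *\<^sub>R \<xi>)) has_vector_derivative \<phi>' \<gamma>) (at \<gamma>)"
      unfolding \<phi>'_def by (rule has_vector_derivative_char_fun[OF prob_\<eta> sets_\<eta> square_\<eta>])
    from has_vector_derivative_mult_right[OF has_vector_derivative_mult[OF m this], of c]
    show ?thesis by (simp add: algebra_simps)
  qed
  have G_deriv: "(G has_real_derivative
      Re (c * (m \<gamma> * \<phi>' \<gamma> - m \<gamma> * \<psi>' \<gamma> * char_fun \<eta> (\<gamma> *\<^sub>R \<xi>)))) (at \<gamma>)" for \<gamma>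
    unfolding G_def has_real_derivative_iff_has_vector_derivative
    by (rule bounded_linear.has_vector_derivative[OF bounded_linear_Re G_vd])
  have stein: "stein_discrepancy (smoothed_gradient H \<gamma>)
      = Re (c * (m \<gamma> * \<phi>' \<gamma> - m \<gamma> * \<psi>' \<gamma> * char_fun \<eta> (\<gamma> *\<^sub>R \<xi>)))" if \<gamma>: "\<gamma> \<in> {0<..<1}" for \<gamma>
  proof -
    let ?k = "c * m \<gamma>"
    have g: "smoothed_gradient H \<gamma> y = Re (?k * \<i> * iexp (\<gamma> * (\<xi> \<bullet> y))) *\<^sub>R \<xi>" for y
    proof -
      have "smoothed_gradient H \<gamma> y
          = (\<integral>z. Re (c * \<i> * iexp (\<xi> \<bullet> (\<gamma> *\<^sub>R y)) * iexp (\<xi> \<bullet> z)) *\<^sub>R \<xi> \<partial>cofactor \<gamma>)"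
        unfolding smoothed_gradient_def H_def inner_add_right of_real_add distrib_left exp_add mult.assoc ..
      also have "\<dots> = (\<integral>z. Re (c * \<i> * iexp (\<xi> \<bullet> (\<gamma> *\<^sub>R y)) * iexp (\<xi> \<bullet> z)) \<partial>cofactor \<gamma>) *\<^sub>R \<xi>"
      proof (rule integral_scaleR_left)
        show "integrable (cofactor \<gamma>) (\<lambda>z. Re (c * \<i> * iexp (\<xi> \<bullet> (\<gamma> *\<^sub>R y)) * iexp (\<xi> \<bullet> z)))"
          using integrable_cofactor[OF \<gamma>, of "\<lambda>z. iexp (\<xi> \<bullet> z)" 1 0]
          by (intro integrable_Re integrable_mult_right) simp
      qed
      also have "\<dots> = Re (c * \<i> * iexp (\<xi> \<bullet> (\<gamma> *\<^sub>R y)) * m \<gamma>) *\<^sub>R \<xi>"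
        unfolding integral_monomial[OF cofactor(1,2)[OF \<gamma>]] cofactor(3)[OF \<gamma>] m_def ..
      also have "c * \<i> * iexp (\<xi> \<bullet> (\<gamma> *\<^sub>R y)) * m \<gamma> = ?k * \<i> * iexp (\<gamma> * (\<xi> \<bullet> y))"
        by (simp add: mult_ac)
      finally show ?thesis .
    qed
    have 1: "(\<integral>y. y \<bullet> smoothed_gradient H \<gamma> y \<partial>\<eta>) = Re (?k * \<phi>' \<gamma>)"
    proof -
      have i: "integrable \<eta> (\<lambda>y. \<i> * complex_of_real (\<xi> \<bullet> y) * iexp (\<gamma> * (\<xi> \<bullet> y)))"
        by (rule Bochner_Integration.integrable_bound[OF integrable_inner(2)[OF prob_\<eta> sets_\<eta> square_\<eta>, of \<xi>]])
           (auto simp: norm_mult)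
      have "y \<bullet> smoothed_gradient H \<gamma> y = Re (?k * (\<i> * complex_of_real (\<xi> \<bullet> y) * iexp (\<gamma> * (\<xi> \<bullet> y))))" for y
      proof -
        have "?k * (\<i> * complex_of_real (\<xi> \<bullet> y) * iexp (\<gamma> * (\<xi> \<bullet> y)))
            = complex_of_real (\<xi> \<bullet> y) * (?k * \<i> * iexp (\<gamma> * (\<xi> \<bullet> y)))" by (simp add: mult_ac)
        then show ?thesis unfolding g by (simp only: inner_scaleR_right inner_commute[of y] Re_complex_of_real
            Im_complex_of_real times_complex.sel(1)[of "complex_of_real _"] mult.commute mult_zero_left diff_zero mult_zero_right)
      qed
      then show ?thesis unfolding \<phi>'_def
        using integral_Re[OF integrable_mult_right[OF i, of ?k]] i by (simp del: times_complex.sel)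
    qed
    have 2: "(\<integral>p. increment (smoothed_gradient H \<gamma>) p \<bullet> fst p \<partial>(\<nu> \<Otimes>\<^sub>M \<eta>))
        = Re (?k * (\<psi>' \<gamma> * char_fun \<eta> (\<gamma> *\<^sub>R \<xi>)))"
    proof -
      let ?B = "\<lambda>u. \<i> * complex_of_real (\<xi> \<bullet> u) * (iexp (\<gamma> * (\<xi> \<bullet> u)) - 1)"
      \<comment> \<open>The increment of an exponential splits into a function of the jump times a
        function of the base point, so Fubini turns the jump term into a product.\<close>
      let ?f = "\<lambda>u y. ?B u * iexp (\<gamma> * (\<xi> \<bullet> y))"
      have i: "integrable (\<nu> \<Otimes>\<^sub>M \<eta>) (case_prod ?f)"
        by (rule Bochner_Integration.integrable_bound[OF integrable_fst(1)[OF
            integrable_levy_exponent_derivative[OF sets_\<nu> square_\<nu>, of \<xi> \<gamma>]]])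
           (auto simp: norm_mult)
      have "increment (smoothed_gradient H \<gamma>) p \<bullet> fst p = Re (?k * case_prod ?f p)" for p
      proof -
        obtain u y where p: "p = (u, y)" by (cases p)
        let ?v = "?k * \<i> * iexp (\<gamma> * (\<xi> \<bullet> (y + u)))" and ?w = "?k * \<i> * iexp (\<gamma> * (\<xi> \<bullet> y))"
        have e: "?k * ?f u y = complex_of_real (\<xi> \<bullet> u) * (?v - ?w)"
          by (simp add: algebra_simps exp_add inner_add_right)
        have r: "Re (complex_of_real t * z) = Re z * t" for t z by simp
        have "increment (smoothed_gradient H \<gamma>) p \<bullet> fst p = (Re ?v - Re ?w) * (\<xi> \<bullet> u)"
          unfolding g p fst_conv snd_conv scaleR_diff_left[symmetric] inner_scaleR_left ..
        then show ?thesis unfolding p case_prod_conv e r minus_complex.sel(1) .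
      qed
      then have "(\<integral>p. increment (smoothed_gradient H \<gamma>) p \<bullet> fst p \<partial>(\<nu> \<Otimes>\<^sub>M \<eta>))
          = Re (?k * (\<integral>p. case_prod ?f p \<partial>(\<nu> \<Otimes>\<^sub>M \<eta>)))"
        using integral_Re[OF integrable_mult_right[OF i, of ?k]] by (simp only: integral_mult_right_zero)
      also have "(\<integral>p. case_prod ?f p \<partial>(\<nu> \<Otimes>\<^sub>M \<eta>)) = (\<integral>u. (\<integral>y. ?f u y \<partial>\<eta>) \<partial>\<nu>)"
        by (rule \<nu>\<eta>.integral_fst[OF i, symmetric])
      also have "\<dots> = (\<integral>u. ?B u * char_fun \<eta> (\<gamma> *\<^sub>R \<xi>) \<partial>\<nu>)"
        unfolding char_fun_def by (simp only: integral_mult_right_zero inner_scaleR_left)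
      also have "\<dots> = \<psi>' \<gamma> * char_fun \<eta> (\<gamma> *\<^sub>R \<xi>)"
        unfolding \<psi>'_def by (rule integral_mult_left_zero)
      finally show ?thesis .
    qed
    show ?thesis unfolding stein_discrepancy_def 1 2 minus_complex.sel(1)[symmetric]
      by (simp add: algebra_simps del: minus_complex.sel times_complex.sel)
  qed
  show ?thesis
    unfolding interpolable_def
  proof (intro exI[of _ H] exI[of _ G] conjI allI ballI)
    show "continuous_on {0..1} G"
      using G_deriv DERIV_isCont continuous_at_imp_continuous_on by blast
    show "G 0 = (\<integral>x. Re (c * iexp (\<xi> \<bullet> x)) \<partial>\<mu>)"
    proof -
      have "levy_exponent \<nu> 0 = 0" "char_fun \<eta> 0 = 1"
        by (simp_all add: levy_exponent_def char_fun_def \<eta>.prob_space)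
      then show ?thesis
        unfolding integral_monomial[OF prob_\<mu> sets_\<mu>] G_def m_def char_fun_\<mu> by simp
    qed
    show "G 1 = (\<integral>x. Re (c * iexp (\<xi> \<bullet> x)) \<partial>\<eta>)"
      unfolding integral_monomial[OF prob_\<eta> sets_\<eta>] G_def m_def by simp
    show "(G has_real_derivative stein_discrepancy (smoothed_gradient H \<gamma>)) (at \<gamma>)"
      if "\<gamma> \<in> {0<..<1}" for \<gamma> using G_deriv stein[OF that] by simp
  qed (use H_bl H_grad in auto)
qed

text \<open>Every clause of \<open>interpolable\<close> is additive in the function, its gradient
  and the curve taken together, so the single-frequency case suffices.\<close>

lemma interpolable_trig_poly:
  assumes "trig_poly h"
  shows "interpolable h"
  using assms
proof (induction rule: trig_poly.induct)
  case (monomial c \<xi>)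
  show ?case by (rule interpolable_monomial)
next
  case (add f g)
  obtain F P where F: "bounded_lipschitz F" "\<And>x. (f has_derivative (\<lambda>w. F x \<bullet> w)) (at x)"
    "continuous_on {0..1} P" "P 0 = (\<integral>x. f x \<partial>\<mu>)" "P 1 = (\<integral>y. f y \<partial>\<eta>)"
    "\<And>\<gamma>. \<gamma> \<in> {0<..<1} \<Longrightarrow> (P has_real_derivative stein_discrepancy (smoothed_gradient F \<gamma>)) (at \<gamma>)"
    using add.IH(1) unfolding interpolable_def by blast
  obtain H Q where H: "bounded_lipschitz H" "\<And>x. (g has_derivative (\<lambda>w. H x \<bullet> w)) (at x)"
    "continuous_on {0..1} Q" "Q 0 = (\<integral>x. g x \<partial>\<mu>)" "Q 1 = (\<integral>y. g y \<partial>\<eta>)"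
    "\<And>\<gamma>. \<gamma> \<in> {0<..<1} \<Longrightarrow> (Q has_real_derivative stein_discrepancy (smoothed_gradient H \<gamma>)) (at \<gamma>)"
    using add.IH(2) unfolding interpolable_def by blast
  obtain B B' where B: "\<And>x. \<bar>f x\<bar> \<le> B" "\<And>x. \<bar>g x\<bar> \<le> B'"
    using add trig_poly_bounded by meson
  have i: "integrable M f \<and> integrable M g" if "prob_space M" "sets M = sets borel" for M :: "'a measure"
    using integrable_shift_bounded[OF that trig_poly_measurable[OF add.hyps(1)], of B 0]
      integrable_shift_bounded[OF that trig_poly_measurable[OF add.hyps(2)], of B' 0] B by simp
  have sg: "smoothed_gradient (\<lambda>x. F x + H x) \<gamma> = (\<lambda>x. smoothed_gradient F \<gamma> x + smoothed_gradient H \<gamma> x)"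
    if "\<gamma> \<in> {0<..<1}" for \<gamma>
  proof
    fix x
    obtain C C' where "\<And>x. norm (F x) \<le> C" "\<And>x. norm (H x) \<le> C'"
      using F(1) H(1) unfolding bounded_lipschitz_def by blast
    then show "smoothed_gradient (\<lambda>x. F x + H x) \<gamma> x = smoothed_gradient F \<gamma> x + smoothed_gradient H \<gamma> x"
      unfolding smoothed_gradient_def
      by (intro Bochner_Integration.integral_add integrable_cofactor[OF that]
          bounded_lipschitz_measurable F(1) H(1))
  qed
  show ?case
    unfolding interpolable_def
  proof (intro exI[of _ "\<lambda>x. F x + H x"] exI[of _ "\<lambda>\<gamma>. P \<gamma> + Q \<gamma>"] conjI allI ballI)
    show "bounded_lipschitz (\<lambda>x. F x + H x)" by (rule bounded_lipschitz_add[OF F(1) H(1)])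
    show "((\<lambda>x. f x + g x) has_derivative (\<lambda>w. (F x + H x) \<bullet> w)) (at x)" for x
      unfolding inner_add_left by (rule has_derivative_add[OF F(2) H(2)])
    show "continuous_on {0..1} (\<lambda>\<gamma>. P \<gamma> + Q \<gamma>)" by (rule continuous_on_add[OF F(3) H(3)])
    show "P 0 + Q 0 = (\<integral>x. f x + g x \<partial>\<mu>)" using i[OF prob_\<mu> sets_\<mu>] F(4) H(4) by simp
    show "P 1 + Q 1 = (\<integral>x. f x + g x \<partial>\<eta>)" using i[OF prob_\<eta> sets_\<eta>] F(5) H(5) by simp
    show "((\<lambda>\<gamma>. P \<gamma> + Q \<gamma>) has_real_derivative
        stein_discrepancy (smoothed_gradient (\<lambda>x. F x + H x) \<gamma>)) (at \<gamma>)" if "\<gamma> \<in> {0<..<1}" for \<gamma>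
      unfolding sg[OF that] stein_discrepancy_add[OF bounded_lipschitz_smoothed_gradient[OF that F(1)]
          bounded_lipschitz_smoothed_gradient[OF that H(1)]]
      by (rule DERIV_add[OF F(6)[OF that] H(6)[OF that]])
  qed
qed

end

section \<open>The Stein discrepancy under a Poincare inequality\<close>

context self_decomposable_comparison
begin

text \<open>Tonelli brings the right-hand side of the Poincare inequality to the product measure.
  The integral there is finite, so its value can be handled as a real number.\<close>

lemma integral_increments_eq_iterated:
  assumes f: "\<And>x y. norm (f x - f y) \<le> K * norm (x - y)"
  shows "(\<integral>\<^sup>+y. (\<integral>\<^sup>+u. ennreal ((norm (f (y + u) - f y))\<^sup>2) \<partial>\<nu>) \<partial>\<eta>)
    = ennreal (\<integral>p. (norm (increment f p))\<^sup>2 \<partial>(\<nu> \<Otimes>\<^sub>M \<eta>))"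
proof -
  note [measurable] = lipschitz_measurable[of f, OF f]
  have "(\<integral>\<^sup>+y. (\<integral>\<^sup>+u. ennreal ((norm (f (y + u) - f y))\<^sup>2) \<partial>\<nu>) \<partial>\<eta>)
      = (\<integral>\<^sup>+p. ennreal ((norm (increment f p))\<^sup>2) \<partial>(\<nu> \<Otimes>\<^sub>M \<eta>))"
    using \<nu>\<eta>.nn_integral_snd[of "\<lambda>p. ennreal ((norm (increment f p))\<^sup>2)"] by simp
  also have "\<dots> = ennreal (\<integral>p. (norm (increment f p))\<^sup>2 \<partial>(\<nu> \<Otimes>\<^sub>M \<eta>))"
    using integrable_increments[OF f f]
    by (intro nn_integral_eq_integral) (auto simp: power2_norm_eq_inner)
  finally show ?thesis .
qed

text \<open>As \<open>Y\<close> is centered, \<open>f\<close> may be replaced by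
  \<open>f - c\<close> with \<open>c\<close> its mean. Cauchy--Schwarz then leaves the variance of
  \<open>f\<close>, which the Poincare inequality bounds by the jump energy.\<close>

lemma poincare_lipschitz:
  assumes U: "0 \<le> U" and poincare: "poincare_inequality \<nu> \<eta> U" and centered: "(\<integral>y. y \<partial>\<eta>) = 0"
    and f: "\<And>x y. norm (f x - f y) \<le> K * norm (x - y)"
  shows "(\<integral>y. y \<bullet> f y \<partial>\<eta>)\<^sup>2
    \<le> U * (\<integral>y. (norm y)\<^sup>2 \<partial>\<eta>) * (\<integral>p. (norm (increment f p))\<^sup>2 \<partial>(\<nu> \<Otimes>\<^sub>M \<eta>))"
proof -
  note [measurable] = lipschitz_measurable[of f, OF f]
  define c where "c = (\<integral>z. f z \<partial>\<eta>)"
  define V where "V = (\<integral>y. (norm (f y - c))\<^sup>2 \<partial>\<eta>)"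
  have fc: "norm ((f x - c) - (f y - c)) \<le> K * norm (x - y)" for x y using f by simp
  note int_fc = integrable_inner_lipschitz[of "\<lambda>y. f y - c", OF fc]
  have "f \<in> H_space \<nu> \<eta>"
    unfolding H_space_def
  proof (intro CollectI conjI)
    have "(\<integral>\<^sup>+y. ennreal ((norm (f y))\<^sup>2) \<partial>\<eta>) = ennreal (\<integral>y. (norm (f y))\<^sup>2 \<partial>\<eta>)"
      by (rule nn_integral_eq_integral[OF integrable_inner_lipschitz(1)[of f, OF f]]) auto
    then show "(\<integral>\<^sup>+y. ennreal ((norm (f y))\<^sup>2) \<partial>\<eta>) < \<infinity>" by simp
    show "(\<integral>\<^sup>+y. (\<integral>\<^sup>+u. ennreal ((norm (f (y + u) - f y))\<^sup>2) \<partial>\<nu>) \<partial>\<eta>) < \<infinity>"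
      unfolding integral_increments_eq_iterated[OF f] by simp
  qed measurable
  then have "(\<integral>\<^sup>+y. ennreal ((norm (f y - c))\<^sup>2) \<partial>\<eta>)
      \<le> ennreal U * (\<integral>\<^sup>+y. (\<integral>\<^sup>+u. ennreal ((norm (f (y + u) - f y))\<^sup>2) \<partial>\<nu>) \<partial>\<eta>)"
    using poincare unfolding poincare_inequality_def c_def by blast
  moreover have "(\<integral>\<^sup>+y. ennreal ((norm (f y - c))\<^sup>2) \<partial>\<eta>) = ennreal V"
    unfolding V_def by (rule nn_integral_eq_integral[OF int_fc(1)]) auto
  ultimately have V: "V \<le> U * (\<integral>p. (norm (increment f p))\<^sup>2 \<partial>(\<nu> \<Otimes>\<^sub>M \<eta>))"
    unfolding integral_increments_eq_iterated[OF f] using U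
    by (simp add: ennreal_mult[symmetric] ennreal_le_iff)
  have "(\<integral>y. y \<bullet> f y \<partial>\<eta>) = (\<integral>y. y \<bullet> (f y - c) \<partial>\<eta>)"
  proof -
    have "(\<integral>y. y \<bullet> (f y - c) \<partial>\<eta>) = (\<integral>y. y \<bullet> f y \<partial>\<eta>) - (\<integral>y. y \<bullet> c \<partial>\<eta>)"
      unfolding inner_diff_right using integrable_inner(1)[OF prob_\<eta> sets_\<eta> square_\<eta>]
      by (intro Bochner_Integration.integral_diff integrable_inner_lipschitz(2)[of f, OF f]) auto
    then show ?thesis using integrable_inner(1)[OF prob_\<eta> sets_\<eta> square_\<eta>] centered by simp
  qed
  moreover have "(\<integral>y. y \<bullet> (f y - c) \<partial>\<eta>)\<^sup>2 \<le> (\<integral>y. (norm y)\<^sup>2 \<partial>\<eta>) * V"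
  \<comment> \<open>Cauchy--Schwarz, obtained from the nonnegative form E|aY + b(f(Y) - c)|^2 in
    \<open>a\<close> and \<open>b\<close>.\<close>
  proof (rule conjunct1[OF nonneg_quadratic_form_discriminant])
    fix a b :: real
    have "0 \<le> (\<integral>y. (norm (a *\<^sub>R y + b *\<^sub>R (f y - c)))\<^sup>2 \<partial>\<eta>)" by simp
    also have "\<dots> = (\<integral>y. a\<^sup>2 * (norm y)\<^sup>2 + 2 * a * b * (y \<bullet> (f y - c)) + b\<^sup>2 * (norm (f y - c))\<^sup>2 \<partial>\<eta>)"
      unfolding power2_norm_eq_inner
      by (rule Bochner_Integration.integral_cong)
         (auto simp: inner_add_left inner_add_right inner_commute power2_eq_square algebra_simps)
    also have "\<dots> = a\<^sup>2 * (\<integral>y. (norm y)\<^sup>2 \<partial>\<eta>) + 2 * a * b * (\<integral>y. y \<bullet> (f y - c) \<partial>\<eta>) + b\<^sup>2 * V"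
      unfolding V_def using square_\<eta> int_fc(1,2) by simp
    finally show "0 \<le> a\<^sup>2 * (\<integral>y. (norm y)\<^sup>2 \<partial>\<eta>) + 2 * a * b * (\<integral>y. y \<bullet> (f y - c) \<partial>\<eta>) + b\<^sup>2 * V" .
  qed
  moreover have "(\<integral>y. (norm y)\<^sup>2 \<partial>\<eta>) * V
      \<le> (\<integral>y. (norm y)\<^sup>2 \<partial>\<eta>) * (U * (\<integral>p. (norm (increment f p))\<^sup>2 \<partial>(\<nu> \<Otimes>\<^sub>M \<eta>)))"
    using V by (intro mult_left_mono) auto
  ultimately show ?thesis by (simp add: mult_ac)
qed

text \<open>An instance of \<open>quadratic_form_functional_bound\<close> with v the identity and w
  = \<open>g\<close>, the jump energy as inner product and the pairing with Y as functional. The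
  Poincare inequality for y \<mapsto> a y + b g(y) supplies \<open>dom\<close>, and the energy of
  \<open>g\<close> is at most \<open>K\<^sup>2 * S\<close>.\<close>

lemma stein_discrepancy_bound:
  assumes U: "0 \<le> U" and poincare: "poincare_inequality \<nu> \<eta> U" and centered: "(\<integral>y. y \<partial>\<eta>) = 0"
    and K: "0 \<le> K" and g: "\<And>x y. norm (g x - g y) \<le> K * norm (x - y)"
  defines "E \<equiv> (\<integral>y. (norm y)\<^sup>2 \<partial>\<eta>)" and "S \<equiv> (\<integral>u. (norm u)\<^sup>2 \<partial>\<nu>)"
  shows "\<bar>stein_discrepancy g\<bar> \<le> K * (sqrt S * sqrt (U * E + S - 2 * E))"
    and "0 \<le> U * E + S - 2 * E"
proof -
  define m where "m = (\<integral>y. y \<bullet> g y \<partial>\<eta>)"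
  define q where "q = (\<integral>p. increment g p \<bullet> fst p \<partial>(\<nu> \<Otimes>\<^sub>M \<eta>))"
  define G where "G = (\<integral>p. (norm (increment g p))\<^sup>2 \<partial>(\<nu> \<Otimes>\<^sub>M \<eta>))"
  have iG: "integrable (\<nu> \<Otimes>\<^sub>M \<eta>) (\<lambda>p. (norm (increment g p))\<^sup>2)"
    using integrable_increments[OF g g] by (simp add: power2_norm_eq_inner)
  have iS: "integrable (\<nu> \<Otimes>\<^sub>M \<eta>) (\<lambda>p. (norm (fst p))\<^sup>2)" by (rule integrable_fst(1)[OF square_\<nu>])
  have E0: "0 \<le> E" and S0: "0 \<le> S" unfolding E_def S_def by auto
  have expand: "(a *\<^sub>R u + b *\<^sub>R d) \<bullet> (a *\<^sub>R u + b *\<^sub>R d) = a\<^sup>2 * (u \<bullet> u) + 2 * a * b * (d \<bullet> u) + b\<^sup>2 * (d \<bullet> d)"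
    for a b and u d :: 'a
    by (simp add: inner_add_left inner_add_right power2_eq_square inner_commute[of u d] algebra_simps)
  have energy: "(\<integral>p. (norm (increment (\<lambda>y. a *\<^sub>R y + b *\<^sub>R g y) p))\<^sup>2 \<partial>(\<nu> \<Otimes>\<^sub>M \<eta>))
      = a\<^sup>2 * S + 2 * a * b * q + b\<^sup>2 * G" for a b
  proof -
    have "(\<integral>p. (norm (increment (\<lambda>y. a *\<^sub>R y + b *\<^sub>R g y) p))\<^sup>2 \<partial>(\<nu> \<Otimes>\<^sub>M \<eta>))
        = (\<integral>p. a\<^sup>2 * (norm (fst p))\<^sup>2 + 2 * a * b * (increment g p \<bullet> fst p)
            + b\<^sup>2 * (norm (increment g p))\<^sup>2 \<partial>(\<nu> \<Otimes>\<^sub>M \<eta>))"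
    proof (rule Bochner_Integration.integral_cong[OF refl])
      fix p :: "'a \<times> 'a"
      have "increment (\<lambda>y. a *\<^sub>R y + b *\<^sub>R g y) p = a *\<^sub>R fst p + b *\<^sub>R increment g p"
        by (simp add: algebra_simps)
      then show "(norm (increment (\<lambda>y. a *\<^sub>R y + b *\<^sub>R g y) p))\<^sup>2 = a\<^sup>2 * (norm (fst p))\<^sup>2
          + 2 * a * b * (increment g p \<bullet> fst p) + b\<^sup>2 * (norm (increment g p))\<^sup>2"
        unfolding power2_norm_eq_inner by (simp only: expand)
    qed
    also have "\<dots> = a\<^sup>2 * S + 2 * a * b * q + b\<^sup>2 * G"
      unfolding q_def G_def S_def integrable_fst(2)[OF square_\<nu>, symmetric]
      using iS iG integrable_increment_inner_fst[OF g] by simp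
    finally show ?thesis .
  qed
  have dom: "(a * E + b * m)\<^sup>2 \<le> U * E * (a\<^sup>2 * S + 2 * a * b * q + b\<^sup>2 * G)" for a b
  proof -
    have lip: "norm ((a *\<^sub>R x + b *\<^sub>R g x) - (a *\<^sub>R y + b *\<^sub>R g y)) \<le> (\<bar>a\<bar> + \<bar>b\<bar> * K) * norm (x - y)" for x y
    proof -
      have "(a *\<^sub>R x + b *\<^sub>R g x) - (a *\<^sub>R y + b *\<^sub>R g y) = a *\<^sub>R (x - y) + b *\<^sub>R (g x - g y)"
        by (simp add: algebra_simps)
      also have "norm \<dots> \<le> \<bar>a\<bar> * norm (x - y) + \<bar>b\<bar> * norm (g x - g y)"
        by (rule norm_triangle_le) simp
      also have "\<dots> \<le> \<bar>a\<bar> * norm (x - y) + \<bar>b\<bar> * (K * norm (x - y))"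
        using g by (intro add_left_mono mult_left_mono) auto
      finally show ?thesis by (simp add: algebra_simps)
    qed
    have "(\<integral>y. y \<bullet> (a *\<^sub>R y + b *\<^sub>R g y) \<partial>\<eta>) = (\<integral>y. a * (norm y)\<^sup>2 + b * (y \<bullet> g y) \<partial>\<eta>)"
      by (simp add: inner_add_right power2_norm_eq_inner)
    also have "\<dots> = a * E + b * m"
      unfolding E_def m_def using square_\<eta> integrable_inner_lipschitz(2)[of g, OF g] by simp
    finally show ?thesis
      using poincare_lipschitz[OF U poincare centered lip] unfolding energy E_def[symmetric] by simp
  qed
  have pos: "0 \<le> a\<^sup>2 * S + 2 * a * b * q + b\<^sup>2 * G" for a b
    unfolding energy[symmetric] by simp
  have UE: "0 \<le> U * E" using U E0 by simp
  \<comment> \<open>The constant called \<open>K\<close> in that lemma is \<open>U * E\<close> here,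
    and its \<open>l\<close>, the functional at the identity, is \<open>E\<close>.\<close>
  note bound = quadratic_form_functional_bound[OF UE pos dom]
  show nonneg: "0 \<le> U * E + S - 2 * E" using bound(2) by simp
  have "G \<le> K\<^sup>2 * S"
  proof -
    have "G \<le> (\<integral>p. K\<^sup>2 * (norm (fst p))\<^sup>2 \<partial>(\<nu> \<Otimes>\<^sub>M \<eta>))"
      unfolding G_def
    proof (rule integral_mono[OF iG integrable_mult_right[OF iS]])
      fix p :: "'a \<times> 'a"
      have "norm (increment g p) \<le> K * norm (fst p)" using g[of "snd p + fst p" "snd p"] by simp
      then show "(norm (increment g p))\<^sup>2 \<le> K\<^sup>2 * (norm (fst p))\<^sup>2"
        using power_mono[of _ "K * norm (fst p)" 2] by (simp add: power_mult_distrib)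
    qed
    then show ?thesis unfolding S_def integrable_fst(2)[OF square_\<nu>, symmetric] by simp
  qed
  then have "(m - q)\<^sup>2 \<le> (K\<^sup>2 * S) * (U * E + S - 2 * E)"
    using bound(1) nonneg mult_right_mono[of G "K\<^sup>2 * S" "U * E + S - 2 * E"]
    by (simp add: algebra_simps)
  then have "\<bar>m - q\<bar> \<le> sqrt ((K\<^sup>2 * S) * (U * E + S - 2 * E))"
    using real_le_rsqrt by (metis power2_abs)
  also have "\<dots> = K * (sqrt S * sqrt (U * E + S - 2 * E))"
    using K by (simp add: real_sqrt_mult)
  finally show "\<bar>stein_discrepancy g\<bar> \<le> K * (sqrt S * sqrt (U * E + S - 2 * E))"
    unfolding stein_discrepancy_def m_def q_def .
qed

end

section \<open>From second differences to gradients, and integration along the curve\<close>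

text \<open>Shrinking one side of the parallelogram turns a second difference into the gradient
  increment paired with a direction \<open>w\<close>. The bound holds for all \<open>w\<close>, so
  it controls the Euclidean norm with the same constant.\<close>

lemma gradient_lipschitz:
  fixes h :: "'a::euclidean_space \<Rightarrow> real"
  assumes L: "second_diff_bound L h" and L0: "0 \<le> L"
    and H: "\<And>x. (h has_derivative (\<lambda>w. H x \<bullet> w)) (at x)"
  shows "norm (H x - H y) \<le> L * norm (x - y)"
proof -
  define a where "a = x - y"
  have inner: "(H (y + a) - H y) \<bullet> w \<le> L * norm a * norm w" for w
  proof -
    define k where "k t = h (y + a + t *\<^sub>R w) - h (y + t *\<^sub>R w)" for t
    have line: "((\<lambda>t. h (z + t *\<^sub>R w)) has_real_derivative (H z \<bullet> w)) (at 0)" for z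
    proof -
      have "((\<lambda>t. h (z + t *\<^sub>R w)) has_derivative (\<lambda>t. H (z + 0 *\<^sub>R w) \<bullet> (t *\<^sub>R w))) (at 0)"
        by (rule has_derivative_compose[OF _ H]) (auto intro!: derivative_eq_intros)
      then show ?thesis unfolding has_field_derivative_def by (simp add: mult.commute[of "H z \<bullet> w"] mult_commute_abs)
    qed
    have "(k has_real_derivative ((H (y + a) - H y) \<bullet> w)) (at 0)"
      unfolding k_def inner_diff_left by (intro DERIV_diff line)
    then have "(\<lambda>t. (k (0 + t) - k 0) / t) \<midarrow>0\<rightarrow> (H (y + a) - H y) \<bullet> w"
      by (simp only: DERIV_def)
    then show ?thesis
    proof (rule tendsto_upperbound)
      show "\<forall>\<^sub>F t in at 0. (k (0 + t) - k 0) / t \<le> L * norm a * norm w"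
        unfolding eventually_at_filter
      proof (intro always_eventually allI impI)
        fix t :: real assume "t \<noteq> 0"
        have "\<bar>k t - k 0\<bar> \<le> L * norm a * norm (t *\<^sub>R w)"
          using second_diff_boundD[OF L, of y a "t *\<^sub>R w"] unfolding k_def by (simp add: algebra_simps)
        then have "\<bar>(k t - k 0) / t\<bar> \<le> L * norm a * norm w"
          using \<open>t \<noteq> 0\<close> by (simp add: field_simps)
        from abs_le_D1[OF this] show "(k (0 + t) - k 0) / t \<le> L * norm a * norm w" by simp
      qed
    qed simp
  qed
  \<comment> \<open>The direction \<open>w\<close> is the gradient increment itself.\<close>
  have "norm (H (y + a) - H y) * norm (H (y + a) - H y) \<le> L * norm a * norm (H (y + a) - H y)"
    using inner[of "H (y + a) - H y"] by (simp add: power2_norm_eq_inner[symmetric] power2_eq_square[symmetric])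
  then have "norm (H (y + a) - H y) \<le> L * norm a"
    using L0 by (cases "H (y + a) - H y = 0") auto
  then show ?thesis by (simp add: a_def)
qed

context self_decomposable_comparison
begin

lemma trig_poly_comparison:
  assumes U: "0 \<le> U" and poincare: "poincare_inequality \<nu> \<eta> U" and centered: "(\<integral>y. y \<partial>\<eta>) = 0"
    and h: "trig_poly h" and L: "second_diff_bound L h" and L0: "0 \<le> L"
  defines "E \<equiv> (\<integral>y. (norm y)\<^sup>2 \<partial>\<eta>)" and "S \<equiv> (\<integral>u. (norm u)\<^sup>2 \<partial>\<nu>)"
  shows "\<bar>(\<integral>x. h x \<partial>\<mu>) - (\<integral>y. h y \<partial>\<eta>)\<bar> \<le> L / 2 * (sqrt S * sqrt (U * E + S - 2 * E))"
proof -
  obtain H G where H: "bounded_lipschitz H" and H': "\<And>x. (h has_derivative (\<lambda>w. H x \<bullet> w)) (at x)"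
    and G: "continuous_on {0..1} G" "G 0 = (\<integral>x. h x \<partial>\<mu>)" "G 1 = (\<integral>y. h y \<partial>\<eta>)"
    and G': "\<And>\<gamma>. \<gamma> \<in> {0<..<1} \<Longrightarrow> (G has_real_derivative stein_discrepancy (smoothed_gradient H \<gamma>)) (at \<gamma>)"
    using interpolable_trig_poly[OF h] unfolding interpolable_def by blast
  obtain B where B: "\<And>x. norm (H x) \<le> B" using H unfolding bounded_lipschitz_def by blast
  define D where "D = sqrt S * sqrt (U * E + S - 2 * E)"
  have bd: "\<bar>stein_discrepancy (smoothed_gradient H \<gamma>)\<bar> \<le> \<gamma> * L * D" if \<gamma>: "\<gamma> \<in> {0<..<1}" for \<gamma>
    unfolding D_def E_def S_def
    using \<gamma> L0 smoothed_gradient_lipschitz(2)[OF \<gamma> B gradient_lipschitz[OF L L0 H']]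
    by (intro stein_discrepancy_bound(1)[OF U poincare centered]) auto
  \<comment> \<open>The curve is compared with the parabola of slope \<open>\<gamma> * L * D\<close>
    by monotonicity, which asks for derivatives on the open interval and continuity at the ends, and
    nothing about integrating the derivative.\<close>
  have "G 1 - L * D * 1\<^sup>2 / 2 \<le> G 0 - L * D * 0\<^sup>2 / 2"
  proof (rule DERIV_nonpos_imp_decreasing_open[of 0 1 "\<lambda>\<gamma>. G \<gamma> - L * D * \<gamma>\<^sup>2 / 2"])
    fix \<gamma> :: real assume \<gamma>: "0 < \<gamma>" "\<gamma> < 1"
    have "((\<lambda>\<gamma>. G \<gamma> - L * D * \<gamma>\<^sup>2 / 2) has_real_derivative
        stein_discrepancy (smoothed_gradient H \<gamma>) - \<gamma> * L * D) (at \<gamma>)"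
      using \<gamma> by (auto intro!: derivative_eq_intros G')
    moreover have "stein_discrepancy (smoothed_gradient H \<gamma>) - \<gamma> * L * D \<le> 0" using bd[of \<gamma>] \<gamma> by auto
    ultimately show "\<exists>y. ((\<lambda>\<gamma>. G \<gamma> - L * D * \<gamma>\<^sup>2 / 2) has_real_derivative y) (at \<gamma>) \<and> y \<le> 0" by blast
  qed (auto intro!: continuous_intros G)
  moreover have "G 0 + L * D * 0\<^sup>2 / 2 \<le> G 1 + L * D * 1\<^sup>2 / 2"
  proof (rule DERIV_nonneg_imp_increasing_open[of 0 1 "\<lambda>\<gamma>. G \<gamma> + L * D * \<gamma>\<^sup>2 / 2"])
    fix \<gamma> :: real assume \<gamma>: "0 < \<gamma>" "\<gamma> < 1"
    have "((\<lambda>\<gamma>. G \<gamma> + L * D * \<gamma>\<^sup>2 / 2) has_real_derivative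
        stein_discrepancy (smoothed_gradient H \<gamma>) + \<gamma> * L * D) (at \<gamma>)"
      using \<gamma> by (auto intro!: derivative_eq_intros G')
    moreover have "0 \<le> stein_discrepancy (smoothed_gradient H \<gamma>) + \<gamma> * L * D" using bd[of \<gamma>] \<gamma> by auto
    ultimately show "\<exists>y. ((\<lambda>\<gamma>. G \<gamma> + L * D * \<gamma>\<^sup>2 / 2) has_real_derivative y) (at \<gamma>) \<and> 0 \<le> y" by blast
  qed (auto intro!: continuous_intros G)
  ultimately have "\<bar>G 0 - G 1\<bar> \<le> L / 2 * D" unfolding abs_le_iff by auto
  then show ?thesis unfolding G(2,3)[symmetric] D_def[symmetric] .
qed

text \<open>The approximants have second-difference constant \<open>1 + 2 / real (Suc n)\<close>,
  which tends to 1, and are bounded by 4. Hence both expectations converge by dominated convergence,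
  and the estimates converge to the one with constant 1/2.\<close>

lemma smooth_wasserstein_bound:
  assumes U: "0 \<le> U" and poincare: "poincare_inequality \<nu> \<eta> U" and centered: "(\<integral>y. y \<partial>\<eta>) = 0"
  defines "E \<equiv> (\<integral>y. (norm y)\<^sup>2 \<partial>\<eta>)" and "S \<equiv> (\<integral>u. (norm u)\<^sup>2 \<partial>\<nu>)"
  shows "smooth_wasserstein 2 \<mu> \<eta> \<le> 1 / 2 * (sqrt S * sqrt (U * E + S - 2 * E))"
  unfolding smooth_wasserstein_def
proof (rule cSUP_least)
  show "test_functions 2 \<noteq> ({} :: ('a \<Rightarrow> real) set)" using zero_in_test_functions by blast
  fix h :: "'a \<Rightarrow> real" assume h: "h \<in> test_functions 2"
  define D where "D = sqrt S * sqrt (U * E + S - 2 * E)"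
  obtain q where q: "\<And>n. trig_poly (q n)" "\<And>n. second_diff_bound (1 + 2 / real (Suc n)) (q n)"
    "\<And>n x. \<bar>q n x\<bar> \<le> 4" "\<And>x. (\<lambda>n. q n x) \<longlonglongrightarrow> h x"
    using trig_poly_approximating_sequence[OF test_functions_2D[OF h]] by blast
  have h_meas: "h \<in> borel_measurable borel"
    using h by (intro borel_measurable_continuous_onI) (auto simp: test_functions_def)
  have lim: "(\<lambda>n. \<integral>x. q n x \<partial>M) \<longlonglongrightarrow> (\<integral>x. h x \<partial>M)"
    if "prob_space M" and sets[measurable_cong]: "sets M = sets borel" for M :: "'a measure"
  proof (rule integral_dominated_convergence[where w = "\<lambda>_. 4"])
    interpret prob_space M by fact
    note [measurable] = h_meas trig_poly_measurable[OF q(1)]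
    show "h \<in> borel_measurable M" "\<And>n. q n \<in> borel_measurable M" by measurable
    show "integrable M (\<lambda>_. 4 :: real)" by simp
  qed (use q in auto)
  have "(\<lambda>n. \<bar>(\<integral>x. q n x \<partial>\<mu>) - (\<integral>y. q n y \<partial>\<eta>)\<bar>) \<longlonglongrightarrow> \<bar>(\<integral>x. h x \<partial>\<mu>) - (\<integral>y. h y \<partial>\<eta>)\<bar>"
    by (intro tendsto_intros lim prob_\<mu> prob_\<eta> sets_\<mu> sets_\<eta>)
  moreover have "(\<lambda>n. (1 + 2 * inverse (real (Suc n))) / 2 * D) \<longlonglongrightarrow> (1 + 2 * 0) / 2 * D"
    by (intro tendsto_intros LIMSEQ_inverse_real_of_nat) auto
  moreover have "\<bar>(\<integral>x. q n x \<partial>\<mu>) - (\<integral>y. q n y \<partial>\<eta>)\<bar> \<le> (1 + 2 * inverse (real (Suc n))) / 2 * D" for n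
  proof -
    have "0 \<le> 1 + 2 / real (Suc n)" by simp
    from trig_poly_comparison[OF U poincare centered q(1,2) this]
    show ?thesis unfolding D_def E_def S_def divide_inverse[of 2 "real (Suc n)"] .
  qed
  ultimately have "\<bar>(\<integral>x. h x \<partial>\<mu>) - (\<integral>y. h y \<partial>\<eta>)\<bar> \<le> (1 + 2 * 0) / 2 * D"
    by (intro LIMSEQ_le) auto
  then show "\<bar>(\<integral>x. h x \<partial>\<mu>) - (\<integral>x. h x \<partial>\<eta>)\<bar> \<le> 1 / 2 * (sqrt S * sqrt (U * E + S - 2 * E))"
    by (simp add: D_def)
qed

end

theorem theorem4p3:
  fixes P :: "'p measure" and Q :: "'q measure"
    and X :: "'p \<Rightarrow> real ^ 'd" and Y :: "'q \<Rightarrow> real ^ 'd"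
    and \<mu>X \<mu>Y \<nu> \<Lambda> :: "(real ^ 'd) measure"
    and b :: "real ^ 'd" and k :: "real ^ 'd \<Rightarrow> real \<Rightarrow> real" and U :: real
  assumes "prob_space P" and "X \<in> borel_measurable P" and "\<mu>X = distr P borel X"
    and "integrable P (\<lambda>\<omega>. (norm (X \<omega>))\<^sup>2)" and "(\<integral>\<omega>. X \<omega> \<partial>P) = 0"
    and "nondegenerate \<mu>X" and "self_decomposable \<mu>X"
    and "ID_law \<mu>X b 0 \<nu>"
    and "polar_decomposition \<nu> \<Lambda> k"
    and "\<forall>a b. 0 < a \<longrightarrow> a < b \<longrightarrow> esssup \<Lambda> (\<lambda>x. SUP r\<in>{a<..<b}. ereal (k x r)) < \<infinity>"
    and "prob_space Q" and "Y \<in> borel_measurable Q" and "\<mu>Y = distr Q borel Y"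
    and "integrable Q (\<lambda>\<omega>. (norm (Y \<omega>))\<^sup>2)" and "(\<integral>\<omega>. Y \<omega> \<partial>Q) = 0"
    and "nondegenerate \<mu>Y"
    and "absolutely_continuous \<mu>Y (convolution \<nu> \<mu>Y)"
    and "1 \<le> U" and "poincare_inequality \<nu> \<mu>Y U"
  shows "smooth_wasserstein 2 \<mu>X \<mu>Y
           \<le> real CARD('d) / 2 * sqrt (\<integral>u. (norm u)\<^sup>2 \<partial>\<nu>)
               * sqrt (U * (\<integral>\<omega>. (norm (Y \<omega>))\<^sup>2 \<partial>Q) + (\<integral>u. (norm u)\<^sup>2 \<partial>\<nu>)
                       - 2 * (\<integral>\<omega>. (norm (Y \<omega>))\<^sup>2 \<partial>Q))
         \<and> ((\<integral>\<omega>. (norm (Y \<omega>))\<^sup>2 \<partial>Q) = (\<integral>u. (norm u)\<^sup>2 \<partial>\<nu>) \<longrightarrow>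
           smooth_wasserstein 2 \<mu>X \<mu>Y
             \<le> real CARD('d) / 2 * (\<integral>u. (norm u)\<^sup>2 \<partial>\<nu>) * sqrt (U - 1))"
proof -
  interpret P: prob_space P by fact
  interpret Q: prob_space Q by fact
  note X_meas[measurable] = assms(2) and Y_meas[measurable] = assms(12)
  have \<mu>: "prob_space \<mu>X" "sets \<mu>X = sets borel" "integrable \<mu>X (\<lambda>x. (norm x)\<^sup>2)" "(\<integral>x. x \<partial>\<mu>X) = 0"
    unfolding assms(3) using assms(4,5) P.prob_space_distr[OF X_meas]
    by (simp_all add: integrable_distr_eq integral_distr)
  have \<eta>: "prob_space \<mu>Y" "sets \<mu>Y = sets borel" "integrable \<mu>Y (\<lambda>x. (norm x)\<^sup>2)" "(\<integral>x. x \<partial>\<mu>Y) = 0"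
    unfolding assms(13) using assms(14,15) Q.prob_space_distr[OF Y_meas]
    by (simp_all add: integrable_distr_eq integral_distr)
  have E: "(\<integral>y. (norm y)\<^sup>2 \<partial>\<mu>Y) = (\<integral>\<omega>. (norm (Y \<omega>))\<^sup>2 \<partial>Q)"
    unfolding assms(13) by (simp add: integral_distr)
  have \<nu>: "levy_measure \<nu>" using assms(8) by (simp add: ID_law_def)
  have cf: "char_fun \<mu>X \<xi> = exp (\<i> * complex_of_real (b \<bullet> \<xi>) +
      (\<integral>u. (iexp (\<xi> \<bullet> u) - 1 - \<i> * complex_of_real ((\<xi> \<bullet> u) * indicator (cball 0 1) u)) \<partial>\<nu>))" for \<xi>
    using assms(8) by (simp add: ID_law_def)
  interpret self_decomposable_comparison \<mu>X \<nu> \<mu>Y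
    by (rule self_decomposable_comparison.intro[OF \<mu>(1,2) \<eta>(1-3) sigma_finite_levy_measure[OF \<nu>]
        levy_measure_sets[OF \<nu>] levy_measure_second_moment[OF \<nu> \<mu>(1-3) cf]
        centered_char_fun_eq[OF \<nu> \<mu> cf] assms(7)])
  define S where "S = (\<integral>u. (norm u)\<^sup>2 \<partial>\<nu>)"
  define EY where "EY = (\<integral>\<omega>. (norm (Y \<omega>))\<^sup>2 \<partial>Q)"
  have U: "0 \<le> U" using assms(18) by simp
  have S: "0 \<le> S" unfolding S_def by simp
  \<comment> \<open>The zero field is Lipschitz with constant 0; it is used only to obtain the sign
    of the radicand.\<close>
  have nonneg: "0 \<le> U * EY + S - 2 * EY"
    using stein_discrepancy_bound(2)[OF U assms(19) \<eta>(4), of 0 "\<lambda>_. 0"] unfolding E S_def EY_def by simp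
  have card: "1 \<le> real CARD('d)" by (simp add: Suc_le_eq)
  have "smooth_wasserstein 2 \<mu>X \<mu>Y \<le> 1 / 2 * (sqrt S * sqrt (U * EY + S - 2 * EY))"
    using smooth_wasserstein_bound[OF U assms(19) \<eta>(4)] unfolding E S_def EY_def .
  \<comment> \<open>The sign of the radicand matters for enlarging the factor 1/2, since
    \<open>sqrt\<close> is negative on negative reals.\<close>
  also have "\<dots> \<le> real CARD('d) / 2 * (sqrt S * sqrt (U * EY + S - 2 * EY))"
    using card nonneg S by (intro mult_right_mono) auto
  finally have main: "smooth_wasserstein 2 \<mu>X \<mu>Y
      \<le> real CARD('d) / 2 * sqrt S * sqrt (U * EY + S - 2 * EY)" by (simp only: mult.assoc)
  moreover have "smooth_wasserstein 2 \<mu>X \<mu>Y \<le> real CARD('d) / 2 * S * sqrt (U - 1)" if "EY = S"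
  proof -
    \<comment> \<open>With equal second moments the radicand contains a second factor
      \<open>S\<close>, and the two square roots of \<open>S\<close> multiply to
      \<open>S\<close>.\<close>
    have "U * EY + S - 2 * EY = S * (U - 1)" using that by (simp add: algebra_simps)
    then have "sqrt S * sqrt (U * EY + S - 2 * EY) = S * sqrt (U - 1)"
      using S by (simp add: real_sqrt_mult)
    then show ?thesis using main by (simp only: mult.assoc)
  qed
  ultimately show ?thesis unfolding S_def EY_def by blast
qed

end
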